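(* Let $S=\{(r\cos\varphi,r\sin\varphi):r\in(0,1),\varphi\in(0,\pi)\}\subset\mathbb R^2$ be the open upper unit half disc. For $n,m\in\mathbb N$ let $\omega_{n,m}^{2,0}$ (resp. $\omega_{n,m}^{2,1}$), $m\in\mathbb N$, be the positive zeros of the Bessel function $J_{n-\frac12}$ (resp. of $J'_{n-\frac12}$), and consider the following forms on $S$ given in polar coordinates: $$E_{n,m}^{2,0}=J_{n-\frac12}(\omega_{n,m}^{2,0}r)\cos((n-\tfrac12)\varphi),$$ $$H_{n,m}^{2,0}=i(\omega_{n,m}^{2,0})^{-1}\big(J_{n-\frac12}(\omega_{n,m}^{2,0}r)\big)'\cos((n-\tfrac12)\varphi)\,dr-i(n-\tfrac12)(\omega_{n,m}^{2,0})^{-1}r^{-1}J_{n-\frac12}(\omega_{n,m}^{2,0}r)\sin((n-\tfrac12)\varphi)\,r\,d\varphi,$$ $$E_{n,m}^{2,1}=-(n-\tfrac12)(\omega_{n,m}^{2,1})^{-1}r^{-1}J_{n-\frac12}(\omega_{n,m}^{2,1}r)\cos((n-\tfrac12)\varphi)\,dr+(\omega_{n,m}^{2,1})^{-1}\big(J_{n-\frac12}(\omega_{n,m}^{2,1}r)\big)'\sin((n-\tfrac12)\varphi)\,r\,d\varphi,$$ $$H_{n,m}^{2,1}=-i\,J_{n-\frac12}(\omega_{n,m}^{2,1}r)\sin((n-\tfrac12)\varphi)\,r\,dr\wedge d\varphi.$$ With the exception of $H_{1,m}^{2,0}$ and $E_{1,m}^{2,1}$, $m\in\mathbb N$, the component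 functions (with respect to Cartesian coordinates) of all these forms lie in $H_1(S)$.
   Context: $\mathbb N=\{1,2,\dots\}$; $J_\nu$ is the Bessel function of the first kind of order $\nu$; the prime on $\big(J_\nu(\omega r)\big)'$ denotes the derivative with respect to $r$. $H_1(S)$ is the Sobolev space of functions in $L_2(S)$ with weak first derivatives in $L_2(S)$. The Cartesian components of a form are its coefficients with respect to $1$; $dx^1,dx^2$; $dx^1\wedge dx^2$, obtained by substituting $dr=\frac{x_1}{|x|}dx^1+\frac{x_2}{|x|}dx^2$, $d\varphi=-\frac{x_2}{|x|^2}dx^1+\frac{x_1}{|x|^2}dx^2$. *)

theory Defs
  imports "HOL-Analysis.Analysis"
begin

subsection \<open>Bessel functions of the first kind\<close>

text \<open>Intended for arguments \<open>x > 0\<close>. Using the reciprocal Gamma function makes the terms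
  with \<open>\<nu> + k + 1 \<in> {0, -1, -2, ...}\<close> vanish, as usual.\<close>

definition bessel_J :: "real \<Rightarrow> real \<Rightarrow> real" where
  "bessel_J \<nu> x =
     (x / 2) powr \<nu> * (\<Sum>k. (-1) ^ k / fact k * rGamma (\<nu> + real k + 1) * (x / 2) ^ (2 * k))"


subsection \<open>The Sobolev space of order one\<close>

text \<open>\<open>Ck k f\<close>: all iterated partial derivatives of \<open>f\<close> of order at most \<open>k\<close> exist
  and are continuous.\<close>

primrec Ck :: "nat \<Rightarrow> ('a::euclidean_space \<Rightarrow> real) \<Rightarrow> bool" where
  "Ck 0 f \<longleftrightarrow> continuous_on UNIV f"
| "Ck (Suc k) f \<longleftrightarrow>
     f differentiable_on UNIV \<and> (\<forall>b\<in>Basis. Ck k (\<lambda>x. frechet_derivative f (at x) b))"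

definition test_function :: "'a::euclidean_space set \<Rightarrow> ('a \<Rightarrow> real) \<Rightarrow> bool" where
  "test_function S \<psi> \<longleftrightarrow>
     (\<forall>k. Ck k \<psi>) \<and> compact (closure {x. \<psi> x \<noteq> 0}) \<and> closure {x. \<psi> x \<noteq> 0} \<subseteq> S"

definition L2 :: "'a::euclidean_space set \<Rightarrow> ('a \<Rightarrow> complex) set" where
  "L2 S = {u. u \<in> borel_measurable (lebesgue_on S) \<and>
              integrable (lebesgue_on S) (\<lambda>x. (norm (u x))\<^sup>2)}"

text \<open>\<open>g\<close> is the weak partial derivative of \<open>u\<close> in direction \<open>b\<close> on the open set \<open>S\<close>.
  Only meaningful for locally integrable \<open>u\<close> and \<open>g\<close>; below both are in \<open>L2 S\<close>.
  Real test functions suffice, by linearity.\<close>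

definition weak_partial ::
    "'a::euclidean_space set \<Rightarrow> 'a \<Rightarrow> ('a \<Rightarrow> complex) \<Rightarrow> ('a \<Rightarrow> complex) \<Rightarrow> bool" where
  "weak_partial S b u g \<longleftrightarrow>
     (\<forall>\<psi>. test_function S \<psi> \<longrightarrow>
        integral\<^sup>L (lebesgue_on S) (\<lambda>x. frechet_derivative \<psi> (at x) b *\<^sub>R u x) =
        - integral\<^sup>L (lebesgue_on S) (\<lambda>x. \<psi> x *\<^sub>R g x))"

definition H1 :: "'a::euclidean_space set \<Rightarrow> ('a \<Rightarrow> complex) set" where
  "H1 S = {u \<in> L2 S. \<forall>b\<in>Basis. \<exists>g\<in>L2 S. weak_partial S b u g}"


subsection \<open>Differential forms in the plane and polar coordinates\<close>

text \<open>Forms are given by their Cartesian coefficients: a 0-form by its coefficient of \<open>1\<close>,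
  a 1-form by its coefficients of \<open>dx\<^sup>1\<close>, \<open>dx\<^sup>2\<close>, a 2-form by its coefficient
  of \<open>dx\<^sup>1 \<and> dx\<^sup>2\<close>.\<close>

type_synonym point = "real \<times> real"
type_synonym form0 = "point \<Rightarrow> complex"
type_synonym form1 = "point \<Rightarrow> complex \<times> complex"
type_synonym form2 = "point \<Rightarrow> complex"

definition dr :: form1 where
  "dr x = (of_real (fst x / norm x), of_real (snd x / norm x))"

definition d\<phi> :: form1 where
  "d\<phi> x = (of_real (- snd x / (norm x)\<^sup>2), of_real (fst x / (norm x)\<^sup>2))"

definition add1 :: "form1 \<Rightarrow> form1 \<Rightarrow> form1" where
  "add1 \<alpha> \<beta> = (\<lambda>x. \<alpha> x + \<beta> x)"

definition mult1 :: "form0 \<Rightarrow> form1 \<Rightarrow> form1" where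
  "mult1 f \<alpha> = (\<lambda>x. (f x * fst (\<alpha> x), f x * snd (\<alpha> x)))"

definition wedge11 :: "form1 \<Rightarrow> form1 \<Rightarrow> form2" where
  "wedge11 \<alpha> \<beta> = (\<lambda>x. fst (\<alpha> x) * snd (\<beta> x) - snd (\<alpha> x) * fst (\<beta> x))"

definition mult2 :: "form0 \<Rightarrow> form2 \<Rightarrow> form2" where
  "mult2 f \<alpha> = (\<lambda>x. f x * \<alpha> x)"

text \<open>The function with the given expression \<open>f r \<phi>\<close> in polar coordinates;
  the angle is taken in \<open>(-\<pi>, \<pi>]\<close>.\<close>

definition polar :: "(real \<Rightarrow> real \<Rightarrow> complex) \<Rightarrow> form0" where
  "polar f x = f (norm x) (Arg (Complex (fst x) (snd x)))"

definition components0 :: "form0 \<Rightarrow> (point \<Rightarrow> complex) set" where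
  "components0 F = {F}"

definition components1 :: "form1 \<Rightarrow> (point \<Rightarrow> complex) set" where
  "components1 F = {\<lambda>x. fst (F x), \<lambda>x. snd (F x)}"

definition components2 :: "form2 \<Rightarrow> (point \<Rightarrow> complex) set" where
  "components2 F = {F}"


subsection \<open>The half disc and the forms on it\<close>

definition half_disc :: "point set" where
  "half_disc = {(r * cos \<phi>, r * sin \<phi>) | r \<phi>. r \<in> {0<..<1} \<and> \<phi> \<in> {0<..<pi}}"

definition E20 :: "nat \<Rightarrow> real \<Rightarrow> form0" where
  "E20 n \<omega> = (let \<nu> = real n - 1/2 in
     polar (\<lambda>r \<phi>. of_real (bessel_J \<nu> (\<omega> * r) * cos (\<nu> * \<phi>))))"

definition H20 :: "nat \<Rightarrow> real \<Rightarrow> form1" where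
  "H20 n \<omega> = (let \<nu> = real n - 1/2 in
     add1
      (mult1 (polar (\<lambda>r \<phi>.
         \<i> * of_real (inverse \<omega> * deriv (\<lambda>s. bessel_J \<nu> (\<omega> * s)) r * cos (\<nu> * \<phi>)))) dr)
      (mult1 (polar (\<lambda>r \<phi>.
         - \<i> * of_real (\<nu> * inverse \<omega> * inverse r * bessel_J \<nu> (\<omega> * r) * sin (\<nu> * \<phi>) * r))) d\<phi>))"

definition E21 :: "nat \<Rightarrow> real \<Rightarrow> form1" where
  "E21 n \<omega> = (let \<nu> = real n - 1/2 in
     add1
      (mult1 (polar (\<lambda>r \<phi>.
         of_real (- \<nu> * inverse \<omega> * inverse r * bessel_J \<nu> (\<omega> * r) * cos (\<nu> * \<phi>)))) dr)
      (mult1 (polar (\<lambda>r \<phi>.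
         of_real (inverse \<omega> * deriv (\<lambda>s. bessel_J \<nu> (\<omega> * s)) r * sin (\<nu> * \<phi>) * r))) d\<phi>))"

definition H21 :: "nat \<Rightarrow> real \<Rightarrow> form2" where
  "H21 n \<omega> = (let \<nu> = real n - 1/2 in
     mult2 (polar (\<lambda>r \<phi>. - \<i> * of_real (bessel_J \<nu> (\<omega> * r) * sin (\<nu> * \<phi>) * r)))
       (wedge11 dr d\<phi>))"

end

theory Submission
  imports Defs
begin

text \<open>With \<open>V \<mu> = J\<^bsub>\<mu>\<^esub>(\<omega>r) exp(i\<mu>\<phi>)\<close> and \<open>\<nu> = n - 1/2\<close>, the relations
  \<open>2\<nu>J\<^bsub>\<nu>\<^esub>(x)/x = J\<^bsub>\<nu>-1\<^esub>(x) + J\<^bsub>\<nu>+1\<^esub>(x)\<close> and \<open>2J'\<^bsub>\<nu>\<^esub>(x) = J\<^bsub>\<nu>-1\<^esub>(x) - J\<^bsub>\<nu>+1\<^esub>(x)\<close>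
  turn every Cartesian component into a combination of real and imaginary parts of \<open>V \<nu>\<close>, \<open>V (\<nu> - 1)\<close>, \<open>V (\<nu> + 1)\<close>.
  Now \<open>V \<mu>\<close> is \<open>z powr \<mu>\<close> times an entire function of \<open>r\<^sup>2\<close>, so its gradient is
  \<open>O(r powr (\<mu> - 1))\<close>: for \<open>\<mu> \<ge> 1/2\<close> it is square integrable, and classical derivatives are
  weak ones. Only \<open>n = 1\<close> involves \<open>\<mu> = -1/2\<close>. There \<open>\<partial>V/\<partial>y\<close> is of exact order \<open>r powr (-3/2)\<close> in a
  sector, and pairing it with bumps of height 1 living at distance and scale \<open>1/s\<close> from the origin
  gives at least \<open>c s powr (-1/2)\<close>, whereas a weak derivative in \<open>L\<^sup>2\<close> would force \<open>O(1/s)\<close>.\<close>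

subsection \<open>Classical and weak derivatives\<close>

text \<open>Translation invariance of Lebesgue measure makes every difference quotient of
  \<open>f\<close> in direction \<open>b\<close> integrate to zero. The quotients converge pointwise
  to \<open>f' x b\<close> and are dominated by a constant on a fixed compact set, so dominated
  convergence carries the zero to the limit.\<close>

lemma integral_directional_derivative_zero:
  fixes f :: "'a::euclidean_space \<Rightarrow> complex"
  assumes der: "\<And>x. (f has_derivative f' x) (at x)"
    and cont: "continuous_on UNIV (\<lambda>x. f' x b)"
    and K: "compact K" and out: "\<And>x. x \<notin> K \<Longrightarrow> f x = 0"
  shows "integral\<^sup>L lborel (\<lambda>x. f' x b) = 0"
proof -
  \<comment> \<open>\<open>K'\<close> is \<open>K\<close> swept backwards along \<open>b\<close> by
    all steps up to 1. The steps \<open>h n\<close> below never exceed 1, so every difference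
    quotient vanishes outside \<open>K \<union> K'\<close>.\<close>
  define K' where "K' = {x - t *\<^sub>R b | x t. x \<in> K \<and> t \<in> {0..1::real}}"
  have "compact ((\<lambda>(x, t). x - t *\<^sub>R b) ` (K \<times> {0..1::real}))"
    by (intro compact_continuous_image compact_Times K continuous_intros)
       (auto simp: case_prod_unfold intro!: continuous_intros)
  moreover have "K' = (\<lambda>(x, t). x - t *\<^sub>R b) ` (K \<times> {0..1::real})"
    by (force simp: K'_def)
  ultimately have K': "compact K'" by simp
  have "compact ((\<lambda>x. f' x b) ` (K \<union> {0}))"
    by (intro compact_continuous_image continuous_on_subset[OF cont] compact_Un K) auto
  then obtain M where "M > 0" and M': "\<And>y. y \<in> (\<lambda>x. f' x b) ` (K \<union> {0}) \<Longrightarrow> norm y \<le> M"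
    using compact_imp_bounded bounded_pos by metis
  have M: "\<And>x. x \<in> K \<Longrightarrow> norm (f' x b) \<le> M" and M0: "M \<ge> 0"
    using M' \<open>M > 0\<close> by auto
  have zero: "f' x b = 0" if "x \<notin> K" for x
  proof -
    have "open (- K)" using K by (simp add: compact_imp_closed open_Compl)
    then have "(f has_derivative (\<lambda>_. 0)) (at x)"
      by (rule has_derivative_transform_within_open[OF has_derivative_const]) (use that out in auto)
    from has_derivative_unique[OF der this] show ?thesis by simp
  qed
  have bd: "norm (f' x b) \<le> M" for x using M zero M0 by (cases "x \<in> K") auto
  have contf: "continuous_on UNIV f"
    using der by (auto intro!: continuous_at_imp_continuous_on has_derivative_continuous)
  define h where "h n = inverse (real (Suc n))" for n
  have h: "0 < h n" "h n \<le> 1" for n by (auto simp: h_def field_simps)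
  have h0: "h \<longlonglongrightarrow> 0" unfolding h_def by (rule LIMSEQ_inverse_real_of_nat)
  define q where "q n x = (1 / h n) *\<^sub>R (f (h n *\<^sub>R b + x) - f x)" for n x
  have intf: "integrable lborel f"
  proof -
    have "integrable lborel (\<lambda>x. indicator K x *\<^sub>R f x)"
      using borel_integrable_compact[OF K continuous_on_subset[OF contf]] by auto
    moreover have "(\<lambda>x. indicator K x *\<^sub>R f x) = f" using out by (auto simp: indicator_def fun_eq_iff)
    ultimately show ?thesis by simp
  qed
  have trans: "integrable lborel (\<lambda>x. f (c + x))" "integral\<^sup>L lborel (\<lambda>x. f (c + x)) = integral\<^sup>L lborel f" for c
  proof -
    have [measurable]: "f \<in> borel_measurable borel" using contf by (rule borel_measurable_continuous_onI)
    have e: "lborel = distr lborel borel ((+) c)" by (simp add: lborel_distr_plus)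
    show "integrable lborel (\<lambda>x. f (c + x))"
      using intf by (subst (asm) e) (simp add: integrable_distr_eq)
    show "integral\<^sup>L lborel (\<lambda>x. f (c + x)) = integral\<^sup>L lborel f"
      by (subst (2) e) (simp add: integral_distr)
  qed
  have q0: "integral\<^sup>L lborel (q n) = 0" for n
    unfolding q_def using trans intf by simp
  have qlim: "(\<lambda>n. q n x) \<longlonglongrightarrow> f' x b" for x
  proof -
    have "((\<lambda>t. f (x + t *\<^sub>R b)) has_vector_derivative f' x b) (at 0)"
    proof -
      have "((\<lambda>t. x + t *\<^sub>R b) has_derivative (\<lambda>t. t *\<^sub>R b)) (at (0::real))"
        by (auto intro!: derivative_eq_intros)
      from has_derivative_compose[OF this, of f "f' x"] der
      have "((\<lambda>t. f (x + t *\<^sub>R b)) has_derivative (\<lambda>t. f' x (t *\<^sub>R b))) (at 0)" by simp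
      moreover have "f' x (t *\<^sub>R b) = t *\<^sub>R f' x b" for t
        using der[of x] by (simp add: has_derivative_def bounded_linear.linear linear_cmul)
      ultimately show ?thesis by (simp add: has_vector_derivative_def)
    qed
    then have l: "((\<lambda>t. (1 / \<bar>t\<bar>) *\<^sub>R (f (x + t *\<^sub>R b) - (f x + t *\<^sub>R f' x b))) \<longlongrightarrow> 0) (at 0)"
      by (simp add: has_vector_derivative_def has_derivative_at2)
    \<comment> \<open>The preceding limit divides by \<open>\<bar>t\<bar>\<close>. Under the norm
      the sign of \<open>t\<close> disappears, so division by \<open>t\<close> itself has the same
      limit.\<close>
    have "((\<lambda>t. norm ((1 / t) *\<^sub>R (f (x + t *\<^sub>R b) - f x) - f' x b)) \<longlongrightarrow> 0) (at 0)"
    proof (rule Lim_transform_eventually[OF tendsto_norm_zero[OF l]])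
      have "norm ((1 / \<bar>t\<bar>) *\<^sub>R (f (x + t *\<^sub>R b) - (f x + t *\<^sub>R f' x b))) =
            norm ((1 / t) *\<^sub>R (f (x + t *\<^sub>R b) - f x) - f' x b)" if "t \<noteq> 0" for t
      proof -
        have "(1 / t) *\<^sub>R (f (x + t *\<^sub>R b) - f x) - f' x b = (1 / t) *\<^sub>R (f (x + t *\<^sub>R b) - (f x + t *\<^sub>R f' x b))"
          using that by (simp add: algebra_simps)
        then show ?thesis by simp
      qed
      then show "\<forall>\<^sub>F t in at 0. norm ((1 / \<bar>t\<bar>) *\<^sub>R (f (x + t *\<^sub>R b) - (f x + t *\<^sub>R f' x b))) =
            norm ((1 / t) *\<^sub>R (f (x + t *\<^sub>R b) - f x) - f' x b)"
        by (auto simp: eventually_at_filter)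
    qed
    then have "((\<lambda>t. (1 / t) *\<^sub>R (f (x + t *\<^sub>R b) - f x)) \<longlongrightarrow> f' x b) (at 0)"
      by (rule LIM_zero_cancel[OF tendsto_norm_zero_cancel])
    moreover have "filterlim h (at 0) sequentially"
      using h0 h(1) by (auto simp: filterlim_at h_def)
    ultimately have "(\<lambda>n. (1 / h n) *\<^sub>R (f (x + h n *\<^sub>R b) - f x)) \<longlonglongrightarrow> f' x b"
      by (rule filterlim_compose)
    then show ?thesis by (simp add: q_def add.commute)
  qed
  have qbd: "norm (q n x) \<le> M * indicator (K \<union> K') x" for n x
  proof (cases "x \<in> K \<union> K'")
    case False
    then have "h n *\<^sub>R b + x \<notin> K" using h[of n] unfolding K'_def
      by (fastforce simp: less_imp_le)
    then show ?thesis using False out by (simp add: q_def)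
  next
    case True
    \<comment> \<open>The mean value inequality on the segment from \<open>x\<close> to
      \<open>x + h n *\<^sub>R b\<close> bounds the quotient by \<open>M\<close>, uniformly in
      \<open>n\<close>.\<close>
    have "norm (f (x + h n *\<^sub>R b) - f (x + 0 *\<^sub>R b)) \<le> M * norm (h n - 0)"
    proof (rule differentiable_bound[where S = "{0..1}" and f = "\<lambda>t. f (x + t *\<^sub>R b)" and f' = "\<lambda>t s. f' (x + t *\<^sub>R b) (s *\<^sub>R b)"])
      fix t :: real
      have "((\<lambda>t. x + t *\<^sub>R b) has_derivative (\<lambda>t. t *\<^sub>R b)) (at t within {0..1})"
        by (auto intro!: derivative_eq_intros)
      from has_derivative_compose[OF this, of f "f' (x + t *\<^sub>R b)"] der
      show "((\<lambda>t. f (x + t *\<^sub>R b)) has_derivative (\<lambda>s. f' (x + t *\<^sub>R b) (s *\<^sub>R b))) (at t within {0..1})" by simp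
      have l: "f' y (s *\<^sub>R b) = s *\<^sub>R f' y b" for s y
        using der[of y] by (simp add: has_derivative_def bounded_linear.linear linear_cmul)
      show "onorm (\<lambda>s. f' (x + t *\<^sub>R b) (s *\<^sub>R b)) \<le> M"
        by (rule onorm_le) (auto simp: l bd mult.commute[of M] intro!: mult_left_mono)
    qed (use h[of n] in auto)
    then show ?thesis using True h(1)[of n] by (simp add: q_def pos_divide_le_eq add.commute)
  qed
  have "(\<lambda>n. integral\<^sup>L lborel (q n)) \<longlonglongrightarrow> integral\<^sup>L lborel (\<lambda>x. f' x b)"
  proof (rule integral_dominated_convergence[where w = "\<lambda>x. M * indicator (K \<union> K') x"])
    have "compact (K \<union> K')" using K K' by (rule compact_Un)
    then have "emeasure lborel (K \<union> K') < \<infinity>" "K \<union> K' \<in> sets borel"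
      using emeasure_compact_finite borel_compact by blast+
    then show "integrable lborel (\<lambda>x. M * indicator (K \<union> K') x)" by simp
    show "(\<lambda>x. f' x b) \<in> borel_measurable lborel" using borel_measurable_continuous_onI[OF cont] by simp
    show "q n \<in> borel_measurable lborel" for n
    proof -
      have "continuous_on UNIV (q n)" unfolding q_def
        by (intro continuous_intros continuous_on_compose2[OF contf]) auto
      then show ?thesis using borel_measurable_continuous_onI by auto
    qed
  qed (use qlim qbd in auto)
  then show ?thesis by (simp add: q0 LIMSEQ_const_iff)
qed

text \<open>The derivative is an explicit argument, so that its directional values can serve as
  candidates for weak derivatives. Continuity is stated for each fixed direction, the form in which
  these values enter integrals.\<close>

definition C1_on :: "'a::euclidean_space set \<Rightarrow> ('a \<Rightarrow> complex) \<Rightarrow> ('a \<Rightarrow> 'a \<Rightarrow> complex) \<Rightarrow> bool" where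
  "C1_on S u u' \<longleftrightarrow> (\<forall>x\<in>S. (u has_derivative u' x) (at x)) \<and> (\<forall>b. continuous_on S (\<lambda>x. u' x b))"

lemma C1_on_imp_continuous_on: "C1_on S u u' \<Longrightarrow> continuous_on S u"
  by (auto simp: C1_on_def intro!: continuous_at_imp_continuous_on has_derivative_continuous)

lemma test_function_C1:
  assumes "test_function S \<psi>"
  shows "(\<psi> has_derivative frechet_derivative \<psi> (at x)) (at x)" (is ?A)
    and "b \<in> Basis \<Longrightarrow> continuous_on UNIV (\<lambda>x. frechet_derivative \<psi> (at x) b)"
    and "continuous_on UNIV \<psi>"
proof -
  have 1: "Ck 0 \<psi>" "Ck (Suc 0) \<psi>" using assms unfolding test_function_def by blast+
  then show ?A by (simp add: differentiable_on_def frechet_derivative_works)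
  from 1 show "b \<in> Basis \<Longrightarrow> continuous_on UNIV (\<lambda>x. frechet_derivative \<psi> (at x) b)" "continuous_on UNIV \<psi>"
    by simp_all
qed

text \<open>A bridge from \<open>lebesgue_on S\<close> to \<open>lborel\<close>, where continuous
  functions on compact sets are known to be integrable. The indicator of \<open>K\<close> is kept
  because \<open>f\<close> may take any values outside \<open>S\<close>.\<close>

lemma integrable_continuous_compact_support:
  fixes f :: "'a::euclidean_space \<Rightarrow> 'b::{banach, second_countable_topology}"
  assumes "continuous_on S f" "compact K" "K \<subseteq> S" "S \<in> sets borel" "\<And>x. x \<in> S - K \<Longrightarrow> f x = 0"
  shows "integrable (lebesgue_on S) f"
    and "integral\<^sup>L (lebesgue_on S) f = integral\<^sup>L lborel (\<lambda>x. indicator K x *\<^sub>R f x)"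
proof -
  have S: "S \<in> sets lebesgue" using assms by (metis sets_completionI_sets sets_lborel)
  have eq: "(\<lambda>x. indicator S x *\<^sub>R f x) = (\<lambda>x. indicator K x *\<^sub>R f x)"
    using assms(3,5) by (force simp: indicator_def)
  have i: "integrable lborel (\<lambda>x. indicator K x *\<^sub>R f x)"
    using borel_integrable_compact[OF assms(2) continuous_on_subset[OF assms(1,3)]] by auto
  then have "integrable lebesgue (\<lambda>x. indicator K x *\<^sub>R f x)"
    using integrable_completion[of "\<lambda>x. indicator K x *\<^sub>R f x" lborel] borel_measurable_integrable by blast
  then show "integrable (lebesgue_on S) f"
    using S by (simp add: integrable_restrict_space eq)
  have "integral\<^sup>L (lebesgue_on S) f = integral\<^sup>L lebesgue (\<lambda>x. indicator K x *\<^sub>R f x)"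
    using S by (simp add: integral_restrict_space eq)
  also have "\<dots> = integral\<^sup>L lborel (\<lambda>x. indicator K x *\<^sub>R f x)"
    using i by (intro integral_completion) auto
  finally show "integral\<^sup>L (lebesgue_on S) f = integral\<^sup>L lborel (\<lambda>x. indicator K x *\<^sub>R f x)" .
qed

text \<open>Integration by parts: \<open>\<psi>\<close> times \<open>u\<close>, extended by zero, is
  continuously differentiable on the whole space with compact support, so its directional derivative
  has integral zero, and the product rule splits this integral. As the support is compact inside
  \<open>S\<close>, any growth of \<open>u\<close> at the boundary is harmless.\<close>

lemma C1_imp_weak_partial:
  assumes S: "open S" and u: "C1_on S u u'" and b: "b \<in> Basis"
  shows "weak_partial S b u (\<lambda>x. u' x b)"
  unfolding weak_partial_def
proof (intro allI impI)
  fix \<psi> assume \<psi>: "test_function S \<psi>"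
  note t = test_function_C1[OF \<psi>]
  let ?d = "\<lambda>x. frechet_derivative \<psi> (at x)"
  define K where "K = closure {x. \<psi> x \<noteq> 0}"
  have K: "compact K" "K \<subseteq> S" using \<psi> by (auto simp: test_function_def K_def)
  have \<psi>0: "\<psi> x = 0" if "x \<notin> K" for x using that closure_subset[of "{x. \<psi> x \<noteq> 0}"] by (auto simp: K_def)
  have opK: "open (- K)" using K by (simp add: compact_imp_closed open_Compl)
  have d0: "?d x h = 0" if "x \<notin> K" for x h
  proof -
    have "(\<psi> has_derivative (\<lambda>_. 0)) (at x)"
      by (rule has_derivative_transform_within_open[OF has_derivative_const opK]) (use that \<psi>0 in auto)
    from has_derivative_unique[OF t(1) this] show ?thesis by simp
  qed
  define f where "f x = (if x \<in> S then \<psi> x *\<^sub>R u x else 0)" for x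
  define f' where "f' x h = (if x \<in> S then ?d x h *\<^sub>R u x + \<psi> x *\<^sub>R u' x h else 0)" for x h
  have f0: "f x = 0" if "x \<notin> K" for x using \<psi>0 that by (simp add: f_def)
  have f'0: "f' x h = 0" if "x \<notin> K" for x h using \<psi>0 d0 that by (simp add: f'_def)
  have der: "(f has_derivative f' x) (at x)" for x
  proof (cases "x \<in> S")
    case True
    have "(u has_derivative u' x) (at x)" using u True by (auto simp: C1_on_def)
    from has_derivative_scaleR[OF t(1) this]
    moreover have "f' x = (\<lambda>h. \<psi> x *\<^sub>R u' x h + ?d x h *\<^sub>R u x)"
      using True by (auto simp: f'_def)
    ultimately have "((\<lambda>x. \<psi> x *\<^sub>R u x) has_derivative f' x) (at x)" by simp
    then show ?thesis
      by (rule has_derivative_transform_within_open[OF _ S True]) (simp add: f_def)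
  next
    case False
    then have x: "x \<notin> K" using K by auto
    have "f' x = (\<lambda>_. 0)" using f'0[OF x] by auto
    moreover have "(f has_derivative (\<lambda>_. 0)) (at x)"
      by (rule has_derivative_transform_within_open[OF has_derivative_const opK]) (use x f0 in auto)
    ultimately show ?thesis by simp
  qed
  have cS: "continuous_on S (\<lambda>x. ?d x b *\<^sub>R u x)" "continuous_on S (\<lambda>x. \<psi> x *\<^sub>R u' x b)"
    using u C1_on_imp_continuous_on[OF u]
    by (auto simp: C1_on_def intro!: continuous_intros continuous_on_subset[OF t(2)[OF b]] continuous_on_subset[OF t(3)])
  \<comment> \<open>The open sets \<open>S\<close> and \<open>- K\<close> cover the space. On the
    first the product formula is continuous, on the second the derivative is identically
    zero.\<close>
  have cf': "continuous_on UNIV (\<lambda>x. f' x b)"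
  proof -
    have "continuous_on S (\<lambda>x. f' x b)"
      using continuous_on_add[OF cS] by (simp add: f'_def cong: continuous_on_cong)
    moreover have "continuous_on (- K) (\<lambda>x. f' x b)"
      using f'0 by (subst continuous_on_cong[OF refl, where g = "\<lambda>_. 0"]) auto
    ultimately have "continuous_on (S \<union> - K) (\<lambda>x. f' x b)"
      by (intro continuous_on_open_Un S opK)
    moreover have "S \<union> - K = UNIV" using K by auto
    ultimately show ?thesis by simp
  qed
  have "integral\<^sup>L lborel (\<lambda>x. f' x b) = 0"
    by (rule integral_directional_derivative_zero[OF der cf' K(1) f0])
  moreover have e: "(\<lambda>x. f' x b) = (\<lambda>x. indicator K x *\<^sub>R f' x b)"
    using f'0 by (auto simp: indicator_def)
  moreover have "integral\<^sup>L (lebesgue_on S) (\<lambda>x. f' x b) = integral\<^sup>L lborel (\<lambda>x. indicator K x *\<^sub>R f' x b)"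
    using f'0 K S by (intro integrable_continuous_compact_support continuous_on_subset[OF cf']) auto
  ultimately have "integral\<^sup>L (lebesgue_on S) (\<lambda>x. f' x b) = 0" by metis
  moreover have "integral\<^sup>L (lebesgue_on S) (\<lambda>x. f' x b) =
      integral\<^sup>L (lebesgue_on S) (\<lambda>x. ?d x b *\<^sub>R u x + \<psi> x *\<^sub>R u' x b)"
    using S by (intro Bochner_Integration.integral_cong) (auto simp: f'_def)
  moreover have "integral\<^sup>L (lebesgue_on S) (\<lambda>x. ?d x b *\<^sub>R u x + \<psi> x *\<^sub>R u' x b) =
      integral\<^sup>L (lebesgue_on S) (\<lambda>x. ?d x b *\<^sub>R u x) + integral\<^sup>L (lebesgue_on S) (\<lambda>x. \<psi> x *\<^sub>R u' x b)"
    using K S d0 \<psi>0 by (intro Bochner_Integration.integral_add integrable_continuous_compact_support cS) auto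
  ultimately show "integral\<^sup>L (lebesgue_on S) (\<lambda>x. ?d x b *\<^sub>R u x) = - integral\<^sup>L (lebesgue_on S) (\<lambda>x. \<psi> x *\<^sub>R u' x b)"
    by (simp add: eq_neg_iff_add_eq_0)
qed

subsection \<open>Square integrability on the half disc\<close>

lemma half_disc_eq: "half_disc = {x. norm x < 1 \<and> 0 < snd x}"
proof (intro equalityI subsetI)
  fix x assume "x \<in> half_disc"
  then obtain r \<phi> where x: "x = (r * cos \<phi>, r * sin \<phi>)" "0 < r" "r < 1" "0 < \<phi>" "\<phi> < pi"
    by (auto simp: half_disc_def)
  have "(r * cos \<phi>)\<^sup>2 + (r * sin \<phi>)\<^sup>2 = r\<^sup>2"
    by (simp add: power_mult_distrib flip: distrib_left)
  then show "x \<in> {x. norm x < 1 \<and> 0 < snd x}"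
    using x by (simp add: norm_Pair sin_gt_zero)
next
  fix x :: point assume *: "x \<in> {x. norm x < 1 \<and> 0 < snd x}"
  obtain a b where x: "x = (a, b)" by fastforce
  define z where "z = Complex a b"
  have z: "cmod z < 1" "Im z > 0" using * by (auto simp: x z_def norm_Pair cmod_def)
  then have "z \<noteq> 0" "0 < Arg z" "Arg z < pi"
    using Arg_lt_pi[of z] Arg_eq_0_pi[of z] by auto
  moreover have "z = rcis (cmod z) (Arg z)" by (simp add: rcis_cmod_Arg)
  then have "a = cmod z * cos (Arg z)" "b = cmod z * sin (Arg z)"
    by (metis complex.sel(1) Re_rcis z_def, metis complex.sel(2) Im_rcis z_def)
  ultimately show "x \<in> half_disc"
    unfolding half_disc_def x using z by (intro CollectI exI[of _ "cmod z"] exI[of _ "Arg z"]) auto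
qed

lemma open_half_disc: "open half_disc"
  unfolding half_disc_eq by (intro open_Collect_conj open_Collect_less continuous_intros)

lemma integrable_inverse_sqrt:
  "integrable lborel (\<lambda>t::real. indicator {0..1} t * t powr (-1/2))"
proof (rule integrableI_nonneg)
  have "((\<lambda>t::real. t powr (-1/2)) has_integral (1 powr (-1/2 + 1) / (-1/2 + 1))) {0..1}"
    by (rule has_integral_powr_from_0) auto
  then have "((\<lambda>t. if t \<in> {0..1} then t powr (-1/2) else 0) has_integral (2::real)) UNIV"
    by (simp only: has_integral_restrict_UNIV) simp
  moreover have "(\<lambda>t. if t \<in> {0..1} then t powr (-1/2) else 0) = (\<lambda>t::real. indicator {0..1} t * t powr (-1/2))"
    by (auto simp: indicator_def)
  ultimately have "((\<lambda>t::real. indicator {0..1} t * t powr (-1/2)) has_integral 2) UNIV"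
    by simp
  then have "(\<integral>\<^sup>+t. ennreal (indicator {0..1} t * t powr (-1/2)) \<partial>lborel) = ennreal 2"
    by (intro nn_integral_has_integral_lborel) auto
  then show "(\<integral>\<^sup>+t. ennreal (indicator {0..1} t * t powr (-1/2)) \<partial>lborel) < \<infinity>" by simp
qed auto

text \<open>The norm dominates both \<open>\<bar>fst x\<bar>\<close> and
  \<open>\<bar>snd x\<bar>\<close>, so \<open>1 / r\<close> lies below a product of inverse square
  roots of the coordinates. This replaces integration in polar coordinates by two one-dimensional
  integrals.\<close>

lemma inverse_norm_integrable_half_disc:
  "integrable (lebesgue_on half_disc) (\<lambda>x. inverse (norm x))"
proof -
  define f where "f t = indicator {0..1} t * t powr (-1/2)" for t :: real
  \<comment> \<open>Symmetrised, because the first coordinate takes both signs on the half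
    disc.\<close>
  define p where "p t = f t + f (- t)" for t
  have [measurable]: "p \<in> borel_measurable borel" unfolding p_def f_def by measurable
  have f: "integrable lborel f" unfolding f_def by (rule integrable_inverse_sqrt)
  have p: "integrable lborel p"
    unfolding p_def using f lborel_integrable_real_affine[OF f, of "-1" 0]
    by (intro Bochner_Integration.integrable_add) auto
  have p0: "p t \<ge> 0" for t by (simp add: p_def f_def)
  have "integrable (lborel \<Otimes>\<^sub>M lborel) (\<lambda>x. p (fst x) * p (snd x))"
  proof (rule lborel_pair.Fubini_integrable)
    show "integrable lborel (\<lambda>x. LBINT y. norm (p (fst (x, y)) * p (snd (x, y))))"
      using p p0 by simp
  qed (use p in auto)
  then have "integrable lborel (\<lambda>x. p (fst x) * p (snd x))" by (simp add: lborel_prod)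
  then have "integrable lebesgue (\<lambda>x. p (fst x) * p (snd x))"
    using integrable_completion borel_measurable_integrable by blast
  moreover have "half_disc \<in> sets lebesgue" using open_half_disc by auto
  ultimately have i: "integrable (lebesgue_on half_disc) (\<lambda>x. p (fst x) * p (snd x))"
    using integrable_mult_indicator[of half_disc lebesgue "\<lambda>x. p (fst x) * p (snd x)"]
    by (simp add: integrable_restrict_space)
  show ?thesis
  proof (rule Bochner_Integration.integrable_bound[OF i])
    have "continuous_on half_disc (\<lambda>x. inverse (norm x))"
      by (intro continuous_intros) (auto simp: half_disc_eq zero_prod_def)
    then show "(\<lambda>x. inverse (norm x)) \<in> borel_measurable (lebesgue_on half_disc)"
      using \<open>half_disc \<in> sets lebesgue\<close> by (rule continuous_imp_measurable_on_sets_lebesgue)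
    \<comment> \<open>On the vertical axis the bound fails: there \<open>p (fst x) = 0\<close>,
      since \<open>0 powr (-1/2) = 0\<close> by convention. The axis is a null set, so an almost
      everywhere bound remains.\<close>
    have "{x::point. x \<bullet> (1, 0) = 0} \<in> null_sets lebesgue"
      using negligible_standard_hyperplane[of "(1, 0) :: point" 0]
      by (simp add: negligible_iff_null_sets Basis_prod_def)
    then have "AE x in lebesgue. fst (x::point) \<noteq> 0"
      by (rule AE_I') (auto simp: inner_prod_def)
    then have "AE x in lebesgue_on half_disc. fst x \<noteq> 0"
      using \<open>half_disc \<in> sets lebesgue\<close> by (auto simp: AE_restrict_space_iff elim: eventually_mono)
    then show "AE x in lebesgue_on half_disc. norm (inverse (norm x)) \<le> norm (p (fst x) * p (snd x))"
    proof (rule AE_mp, intro AE_I2 impI)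
      fix x assume "x \<in> space (lebesgue_on half_disc)" and a0: "fst x \<noteq> 0"
      then have x: "norm x < 1" "0 < snd x" by (auto simp: half_disc_eq)
      have pe: "p t = \<bar>t\<bar> powr (-1/2)" if "t \<noteq> 0" "\<bar>t\<bar> \<le> 1" for t
        using that by (cases "t > 0") (auto simp: p_def f_def indicator_def)
      have n: "\<bar>fst x\<bar> \<le> norm x" "\<bar>snd x\<bar> \<le> norm x"
        using norm_fst_le[of "fst x" "snd x"] norm_snd_le[of "snd x" "fst x"] by auto
      have "inverse (norm x) = norm x powr (-1/2) * norm x powr (-1/2)"
        using x by (auto simp: powr_minus_divide inverse_eq_divide simp flip: powr_add)
      \<comment> \<open>splitting \<open>1 / r\<close> into a product makes Fubini applicable\<close>
      also have "\<dots> \<le> \<bar>fst x\<bar> powr (-1/2) * \<bar>snd x\<bar> powr (-1/2)"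
        using n a0 x by (intro mult_mono powr_mono2') auto
      also have "\<dots> = p (fst x) * p (snd x)" using pe a0 x n by simp
      finally show "norm (inverse (norm x)) \<le> norm (p (fst x) * p (snd x))" using p0 by simp
    qed
  qed
qed

text \<open>The square of the assumed bound is \<open>C\<^sup>2 / norm x\<close>, which is
  integrable by the preceding lemma.\<close>

lemma L2_half_discI:
  assumes c: "continuous_on half_disc u"
    and bd: "\<And>x. x \<in> half_disc \<Longrightarrow> norm (u x) \<le> C * norm x powr (-1/2)"
  shows "u \<in> L2 half_disc"
proof -
  have hd: "half_disc \<in> sets lebesgue" using open_half_disc by auto
  have m: "u \<in> borel_measurable (lebesgue_on half_disc)"
    using c hd by (rule continuous_imp_measurable_on_sets_lebesgue)
  have "integrable (lebesgue_on half_disc) (\<lambda>x. (norm (u x))\<^sup>2)"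
  proof (rule Bochner_Integration.integrable_bound)
    show "integrable (lebesgue_on half_disc) (\<lambda>x. C\<^sup>2 * inverse (norm x))"
      using inverse_norm_integrable_half_disc by simp
    show "(\<lambda>x. (norm (u x))\<^sup>2) \<in> borel_measurable (lebesgue_on half_disc)" using m by measurable
    show "AE x in lebesgue_on half_disc. norm ((norm (u x))\<^sup>2) \<le> norm (C\<^sup>2 * inverse (norm x))"
    proof (intro AE_I2)
      fix x assume "x \<in> space (lebesgue_on half_disc)"
      then have x: "x \<in> half_disc" by simp
      then have "norm x > 0" by (auto simp: half_disc_eq)
      have "(norm (u x))\<^sup>2 \<le> (C * norm x powr (-1/2))\<^sup>2" using bd[OF x] by (intro power_mono) auto
      also have "\<dots> = C\<^sup>2 * inverse (norm x)"
        using \<open>norm x > 0\<close> by (simp add: power_mult_distrib power2_eq_square powr_minus_divide inverse_eq_divide flip: powr_add)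
      finally show "norm ((norm (u x))\<^sup>2) \<le> norm (C\<^sup>2 * inverse (norm x))" by simp
    qed
  qed
  then show ?thesis using m by (simp add: L2_def)
qed

text \<open>A sufficient condition for \<open>H1\<close> that survives sums and bounded linear maps.
  The exponent \<open>-1/2\<close> is the worst gradient growth of \<open>V \<mu>\<close> for
  \<open>\<mu> \<ge> 1/2\<close>; its square is still integrable in the plane.\<close>

definition tame :: "(point \<Rightarrow> complex) \<Rightarrow> bool" where
  "tame u \<longleftrightarrow> (\<exists>u' C. C1_on half_disc u u' \<and>
      (\<forall>x\<in>half_disc. norm (u x) \<le> C \<and> (\<forall>b\<in>Basis. norm (u' x b) \<le> C * norm x powr (-1/2))))"

lemma tame_imp_H1:
  assumes "tame u"
  shows "u \<in> H1 half_disc"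
proof -
  obtain u' C where u: "C1_on half_disc u u'"
    and b: "\<And>x. x \<in> half_disc \<Longrightarrow> norm (u x) \<le> C"
    and b': "\<And>x b. x \<in> half_disc \<Longrightarrow> b \<in> Basis \<Longrightarrow> norm (u' x b) \<le> C * norm x powr (-1/2)"
    using assms unfolding tame_def by blast
  have "u \<in> L2 half_disc"
  proof (rule L2_half_discI[OF C1_on_imp_continuous_on[OF u]])
    fix x assume x: "x \<in> half_disc"
    \<comment> \<open>Since \<open>norm x < 1\<close>, the weight is at least 1, so a bounded
      function also satisfies the growth bound of \<open>L2_half_discI\<close>.\<close>
    then have "1 powr (-1/2) \<le> norm x powr (-1/2)" by (intro powr_mono2') (auto simp: half_disc_eq)
    moreover have "C \<ge> 0" using b[OF x] norm_ge_zero order_trans by blast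
    ultimately have "C * 1 \<le> C * norm x powr (-1/2)" by (intro mult_left_mono) auto
    then show "norm (u x) \<le> C * norm x powr (-1/2)" using b[OF x] by simp
  qed
  moreover have "(\<lambda>x. u' x b) \<in> L2 half_disc" if "b \<in> Basis" for b
  proof (rule L2_half_discI)
    show "continuous_on half_disc (\<lambda>x. u' x b)" using u by (simp only: C1_on_def)
  qed (rule b'[OF _ that])
  ultimately show ?thesis
    unfolding H1_def using C1_imp_weak_partial[OF open_half_disc u] by blast
qed

lemma tame_add:
  assumes "tame u" "tame v"
  shows "tame (\<lambda>x. u x + v x)"
proof -
  obtain u' C v' D where u: "C1_on half_disc u u'" "C1_on half_disc v v'"
    and b: "\<And>x. x \<in> half_disc \<Longrightarrow> norm (u x) \<le> C" "\<And>x. x \<in> half_disc \<Longrightarrow> norm (v x) \<le> D"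
    and b': "\<And>x b. x \<in> half_disc \<Longrightarrow> b \<in> Basis \<Longrightarrow> norm (u' x b) \<le> C * norm x powr (-1/2)"
       "\<And>x b. x \<in> half_disc \<Longrightarrow> b \<in> Basis \<Longrightarrow> norm (v' x b) \<le> D * norm x powr (-1/2)"
    using assms unfolding tame_def by metis
  have "C1_on half_disc (\<lambda>x. u x + v x) (\<lambda>x h. u' x h + v' x h)"
    using u by (auto simp: C1_on_def intro!: derivative_intros continuous_intros)
  moreover have "norm (u x + v x) \<le> C + D" if "x \<in> half_disc" for x
    using b[OF that] norm_triangle_mono by blast
  moreover have "norm (u' x h + v' x h) \<le> (C + D) * norm x powr (-1/2)" if "x \<in> half_disc" "h \<in> Basis" for x h
    using norm_triangle_mono[OF b'(1)[OF that] b'(2)[OF that]] by (simp add: distrib_right)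
  ultimately show ?thesis unfolding tame_def by blast
qed

lemma C1_on_bounded_linear:
  assumes "C1_on S u u'" and L: "bounded_linear L"
  shows "C1_on S (\<lambda>x. L (u x)) (\<lambda>x h. L (u' x h))"
  using assms
  by (auto simp: C1_on_def intro!: bounded_linear.has_derivative[OF L] bounded_linear.continuous_on[OF L])

text \<open>Bounded linear is meant over the reals: the lemma is applied to real and imaginary parts
  followed by multiplication with a complex constant.\<close>

lemma tame_bounded_linear:
  assumes "tame u" and L: "bounded_linear L"
  shows "tame (\<lambda>x. L (u x))"
proof -
  obtain u' C where u: "C1_on half_disc u u'"
    and b: "\<And>x. x \<in> half_disc \<Longrightarrow> norm (u x) \<le> C"
    and b': "\<And>x b. x \<in> half_disc \<Longrightarrow> b \<in> Basis \<Longrightarrow> norm (u' x b) \<le> C * norm x powr (-1/2)"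
    using assms unfolding tame_def by blast
  obtain K where K: "K > 0" "\<And>z. norm (L z) \<le> norm z * K" using bounded_linear.pos_bounded[OF L] by blast
  have "norm (L (u x)) \<le> C * K" if "x \<in> half_disc" for x
    using K(2)[of "u x"] mult_right_mono[OF b[OF that], of K] K(1) by linarith
  moreover have "norm (L (u' x h)) \<le> C * K * norm x powr (-1/2)" if "x \<in> half_disc" "h \<in> Basis" for x h
  proof -
    have "norm (u' x h) * K \<le> C * norm x powr (-1/2) * K"
      using b'[OF that] K(1) by (intro mult_right_mono) auto
    then show ?thesis using K(2)[of "u' x h"] by (simp only: mult_ac)
  qed
  ultimately show ?thesis
    unfolding tame_def using C1_on_bounded_linear[OF u L] by blast
qed

subsection \<open>Bessel functions and cylinder waves\<close>

text \<open>The entire factor of the Bessel function in the variable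
  \<open>t = (x/2)\<^sup>2\<close>, that is, the Bessel-Clifford function of order
  \<open>\<nu>\<close> at \<open>- t\<close>. Only the factor \<open>(x/2) powr \<nu>\<close> can be
  singular at the origin.\<close>

definition bessel_series :: "real \<Rightarrow> real \<Rightarrow> real" where
  "bessel_series \<nu> t = (\<Sum>k. (-1) ^ k / fact k * rGamma (\<nu> + real k + 1) * t ^ k)"

lemma bessel_J_eq: "bessel_J \<nu> x = (x / 2) powr \<nu> * bessel_series \<nu> ((x / 2)\<^sup>2)"
  unfolding bessel_J_def bessel_series_def by (simp only: power_mult)

text \<open>Consecutive terms have the ratio
  \<open>\<bar>t\<bar> / ((n + 1) * (\<nu> + n + 1))\<close> in absolute value once
  \<open>\<nu> + n + 1\<close> is positive. The choice of \<open>N\<close> makes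
  \<open>\<nu> + n + 1 \<ge> 1\<close> and \<open>n + 1 \<ge> 2 * \<bar>t\<bar>\<close>, so the
  ratio is at most 1/2.\<close>

lemma bessel_series_summable:
  "summable (\<lambda>k. (-1) ^ k / fact k * rGamma (\<nu> + real k + 1) * t ^ k)"
proof -
  obtain N :: nat where N: "real N \<ge> 2 * \<bar>t\<bar> + \<bar>\<nu>\<bar>" using real_arch_simple by blast
  show ?thesis
  proof (rule summable_ratio_test[where c = "1/2" and N = N])
    fix n assume n: "N \<le> n"
    define z where "z = \<nu> + real n + 1"
    define m where "m = real n + 1"
    have z: "z \<ge> 1" "2 * \<bar>t\<bar> \<le> m" "m > 0" using N n by (auto simp: z_def m_def)
    have "2 * \<bar>t\<bar> \<le> m * z" using z mult_mono[of "2 * \<bar>t\<bar>" m 1 z] by auto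
    then have q: "\<bar>t\<bar> / (m * z) \<le> 1 / 2" using z by (simp add: field_simps)
    have "rGamma (z + 1) = rGamma z / z" using rGamma_plus1[of z] z by (simp add: field_simps)
    then have "norm ((-1) ^ Suc n / fact (Suc n) * rGamma (\<nu> + real (Suc n) + 1) * t ^ Suc n)
        = norm ((-1) ^ n / fact n * rGamma z * t ^ n) * (\<bar>t\<bar> / (m * z))"
      using z by (simp add: z_def m_def abs_mult power_abs add_ac mult_ac)
    also have "\<dots> \<le> norm ((-1) ^ n / fact n * rGamma z * t ^ n) * (1 / 2)"
      by (intro mult_left_mono q) auto
    finally show "norm ((-1) ^ Suc n / fact (Suc n) * rGamma (\<nu> + real (Suc n) + 1) * t ^ Suc n)
        \<le> 1 / 2 * norm ((-1) ^ n / fact n * rGamma (\<nu> + real n + 1) * t ^ n)"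
      by (simp add: z_def)
  qed simp
qed

text \<open>The factor \<open>k + 1\<close> from differentiation cancels against the factorial, and
  the index shift is absorbed by the order. Hence differentiation raises the order by one and flips
  the sign.\<close>

lemma bessel_series_diffs:
  "diffs (\<lambda>k. (-1) ^ k / fact k * rGamma (\<nu> + real k + 1)) k =
    - ((-1) ^ k / fact k * rGamma (\<nu> + 1 + real k + 1))"
proof -
  have "\<nu> + real (Suc k) + 1 = \<nu> + 1 + real k + 1" by simp
  then show ?thesis by (simp only: diffs_def) (simp del: of_nat_Suc)
qed

lemma bessel_series_deriv:
  "(bessel_series \<nu> has_real_derivative - bessel_series (\<nu> + 1) t) (at t)"
proof -
  have "((\<lambda>t. \<Sum>k. (-1) ^ k / fact k * rGamma (\<nu> + real k + 1) * t ^ k) has_real_derivative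
      (\<Sum>k. diffs (\<lambda>k. (-1) ^ k / fact k * rGamma (\<nu> + real k + 1)) k * t ^ k)) (at t)"
    using bessel_series_summable by (rule termdiffs_strong_converges_everywhere)
  moreover have "(\<Sum>k. diffs (\<lambda>k. (-1) ^ k / fact k * rGamma (\<nu> + real k + 1)) k * t ^ k) = - bessel_series (\<nu> + 1) t"
    unfolding bessel_series_diffs bessel_series_def
    using suminf_minus[OF bessel_series_summable[of "\<nu> + 1" t]] by (simp add: mult.assoc)
  ultimately show ?thesis by (simp add: bessel_series_def[abs_def])
qed

lemmas bessel_series_deriv' [derivative_intros] = DERIV_chain2[OF bessel_series_deriv]

lemma continuous_on_bessel_series [continuous_intros]:
  "continuous_on S f \<Longrightarrow> continuous_on S (\<lambda>x. bessel_series \<nu> (f x))"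
  by (rule continuous_on_compose2[of UNIV])
     (auto intro!: continuous_at_imp_continuous_on DERIV_isCont[OF bessel_series_deriv])

text \<open>By the derivative formula, \<open>- t\<close> times the series of order
  \<open>\<nu> + 1\<close> has coefficients \<open>k * a k\<close>. Adding
  \<open>\<nu> * a k\<close> and using \<open>z * rGamma (z + 1) = rGamma z\<close>, valid also at
  the poles of Gamma, gives the coefficients of order \<open>\<nu> - 1\<close>.\<close>

lemma bessel_series_recurrence:
  "\<nu> * bessel_series \<nu> t - t * bessel_series (\<nu> + 1) t = bessel_series (\<nu> - 1) t"
proof -
  define a where "a k = (-1) ^ k / fact k * rGamma (\<nu> + real k + 1)" for k :: nat
  have s: "summable (\<lambda>k. a k * t ^ k)" unfolding a_def by (rule bessel_series_summable)
  have "diffs a k * t ^ k = - ((-1) ^ k / fact k * rGamma (\<nu> + 1 + real k + 1) * t ^ k)" for k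
    using bessel_series_diffs[of \<nu> k] by (simp add: a_def[abs_def])
  then have d: "(\<lambda>k. diffs a k * t ^ k) sums (- bessel_series (\<nu> + 1) t)"
    unfolding bessel_series_def using sums_minus[OF summable_sums[OF bessel_series_summable[of "\<nu> + 1" t]]] by simp
  then have "(\<lambda>k. t * (diffs a k * t ^ k)) sums (t * - bessel_series (\<nu> + 1) t)" by (rule sums_mult)
  then have "(\<lambda>k. real (Suc k) * a (Suc k) * t ^ Suc k) sums (t * - bessel_series (\<nu> + 1) t)"
    by (simp add: diffs_def mult_ac del: of_nat_Suc)
  \<comment> \<open>The shift back to index \<open>k\<close> costs nothing because the term for
    \<open>k = 0\<close> is zero.\<close>
  then have "(\<lambda>k. real k * a k * t ^ k) sums (t * - bessel_series (\<nu> + 1) t)"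
    by (subst (asm) sums_Suc_iff) simp
  from sums_add[OF sums_mult[OF summable_sums[OF s], of \<nu>] this]
  have "(\<lambda>k. \<nu> * (a k * t ^ k) + real k * a k * t ^ k) sums (\<nu> * bessel_series \<nu> t - t * bessel_series (\<nu> + 1) t)"
    by (simp add: bessel_series_def a_def)
  moreover have "\<nu> * (a k * t ^ k) + real k * a k * t ^ k = (-1) ^ k / fact k * rGamma (\<nu> - 1 + real k + 1) * t ^ k" for k
  proof -
    have e: "rGamma (\<nu> - 1 + real k + 1) = (\<nu> + real k) * rGamma (\<nu> + real k + 1)"
      using rGamma_plus1[of "\<nu> + real k"] by simp
    show ?thesis unfolding a_def e by (simp add: algebra_simps add_divide_distrib)
  qed
  ultimately show ?thesis unfolding bessel_series_def[of "\<nu> - 1"] by (simp add: sums_iff)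
qed

lemma bessel_J_recurrence:
  assumes "x > 0"
  shows "2 * \<nu> / x * bessel_J \<nu> x = bessel_J (\<nu> - 1) x + bessel_J (\<nu> + 1) x"
proof -
  define s where "s = x / 2"
  have s: "s > 0" "x = 2 * s" using assms by (auto simp: s_def)
  \<comment> \<open>With all powers reduced to \<open>s powr (\<nu> - 1)\<close>, the claim becomes
    the recurrence of the series at \<open>t = s\<^sup>2\<close>.\<close>
  have "s powr \<nu> = s * s powr (\<nu> - 1)" "s powr (\<nu> + 1) = s * s * s powr (\<nu> - 1)"
    using s by (auto simp: powr_diff powr_add)
  then show ?thesis using s
    by (simp add: bessel_J_eq bessel_series_recurrence[symmetric, of \<nu>] power2_eq_square algebra_simps)
qed

text \<open>The product rule gives the series of orders \<open>\<nu>\<close> and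
  \<open>\<nu> + 1\<close>; the series recurrence rewrites order \<open>\<nu> - 1\<close> through
  these two, after which both sides agree.\<close>

lemma bessel_J_deriv:
  assumes "x > 0"
  shows "(bessel_J \<nu> has_real_derivative (bessel_J (\<nu> - 1) x - bessel_J (\<nu> + 1) x) / 2) (at x)"
proof -
  define s where "s = x / 2"
  have s: "s > 0" "x = 2 * s" using assms by (auto simp: s_def)
  have p: "s powr \<nu> = s * s powr (\<nu> - 1)" "s powr (\<nu> + 1) = s * s * s powr (\<nu> - 1)"
    using s by (auto simp: powr_diff powr_add)
  have "((\<lambda>x. (x / 2) powr \<nu> * bessel_series \<nu> ((x / 2)\<^sup>2)) has_real_derivative
      (\<nu> * s powr (\<nu> - 1) * (1 / 2)) * bessel_series \<nu> (s\<^sup>2) + - bessel_series (\<nu> + 1) (s\<^sup>2) * s * s powr \<nu>) (at x)"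
    using s by (auto intro!: derivative_eq_intros)
  moreover have "(\<nu> * s powr (\<nu> - 1) * (1 / 2)) * bessel_series \<nu> (s\<^sup>2) + - bessel_series (\<nu> + 1) (s\<^sup>2) * s * s powr \<nu>
      = (bessel_J (\<nu> - 1) x - bessel_J (\<nu> + 1) x) / 2"
    using s p by (simp add: bessel_J_eq bessel_series_recurrence[symmetric, of \<nu>] power2_eq_square algebra_simps)
  ultimately show ?thesis by (simp only: bessel_J_eq[abs_def])
qed

section \<open>Cylinder waves as functions of the Cartesian coordinates\<close>

definition as_complex :: "point \<Rightarrow> complex" where "as_complex x = Complex (fst x) (snd x)"

lemma as_complex_simps: "Re (as_complex x) = fst x" "Im (as_complex x) = snd x" "cmod (as_complex x) = norm x"
  by (auto simp: as_complex_def norm_prod_def cmod_def)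

lemma as_complex_half_disc: "x \<in> half_disc \<Longrightarrow> as_complex x \<notin> \<real>\<^sub>\<le>\<^sub>0 \<and> as_complex x \<noteq> 0 \<and> 0 < norm x"
  by (auto simp: half_disc_eq as_complex_def complex_nonpos_Reals_iff zero_prod_def complex_eq_iff)

lemma bounded_linear_as_complex: "bounded_linear as_complex"
proof -
  have "as_complex = (\<lambda>x. of_real (fst x) + \<i> * of_real (snd x))" by (auto simp: as_complex_def complex_eq_iff)
  moreover have "bounded_linear (\<lambda>x::point. of_real (fst x) + \<i> * of_real (snd x) :: complex)"
    by (intro bounded_linear_add bounded_linear_const_mult bounded_linear_of_real
          bounded_linear_compose[OF bounded_linear_of_real] bounded_linear_fst bounded_linear_snd)
  ultimately show ?thesis by simp
qed

text \<open>This is \<open>V \<mu>\<close>, a separated solution of the Helmholtz equation. Being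
  complex valued, it carries the cosine and the sine version together.\<close>

definition cyl_wave :: "real \<Rightarrow> real \<Rightarrow> point \<Rightarrow> complex" where
  "cyl_wave \<mu> \<omega> x = of_real (bessel_J \<mu> (\<omega> * norm x)) * cis (\<mu> * Arg (as_complex x))"

text \<open>The product rule applied to the Cartesian form in \<open>cyl_wave_eq\<close>: the first
  term differentiates the complex power, the second the series, with
  \<open>2 * (x \<bullet> h)\<close> coming from the squared norm.\<close>

definition cyl_wave_deriv :: "real \<Rightarrow> real \<Rightarrow> point \<Rightarrow> point \<Rightarrow> complex" where
  "cyl_wave_deriv \<mu> \<omega> x h = of_real ((\<omega> / 2) powr \<mu>) *
     (of_real \<mu> * as_complex x powr of_real (\<mu> - 1) * as_complex h * of_real (bessel_series \<mu> ((\<omega> / 2)\<^sup>2 * (norm x)\<^sup>2)) -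
      as_complex x powr of_real \<mu> * of_real (bessel_series (\<mu> + 1) ((\<omega> / 2)\<^sup>2 * (norm x)\<^sup>2) * (2 * (\<omega> / 2)\<^sup>2 * (x \<bullet> h))))"

lemma powr_real_polar: "z \<noteq> 0 \<Longrightarrow> z powr of_real a = of_real (cmod z powr a) * cis (a * Arg z)"
  by (simp add: powr_def Ln_Arg cis_conv_exp exp_add[symmetric] exp_of_real[symmetric] algebra_simps
      del: exp_of_real)

text \<open>The radial power and the phase combine to the principal branch of
  \<open>z powr \<mu>\<close>. The other factor depends smoothly on the squared norm, so polar
  coordinates are no longer needed.\<close>

lemma cyl_wave_eq:
  assumes "x \<in> half_disc" "\<omega> > 0"
  shows "cyl_wave \<mu> \<omega> x = of_real ((\<omega> / 2) powr \<mu>) * (as_complex x powr of_real \<mu> * of_real (bessel_series \<mu> ((\<omega> / 2)\<^sup>2 * (norm x)\<^sup>2)))"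
proof -
  have "(\<omega> * norm x / 2) powr \<mu> = (\<omega> / 2) powr \<mu> * norm x powr \<mu>"
    using assms by (simp add: powr_mult[symmetric])
  moreover have "(\<omega> * norm x / 2)\<^sup>2 = (\<omega> / 2)\<^sup>2 * (norm x)\<^sup>2"
    by (simp add: power_mult_distrib power_divide)
  ultimately show ?thesis
    using as_complex_half_disc[OF assms(1)] by (simp add: cyl_wave_def bessel_J_eq powr_real_polar as_complex_simps)
qed

lemma continuous_on_as_complex_powr: "continuous_on half_disc (\<lambda>x. as_complex x powr a)"
proof (intro continuous_at_imp_continuous_on ballI)
  fix x assume "x \<in> half_disc"
  then have "isCont (\<lambda>z. z powr a) (as_complex x)"
    using as_complex_half_disc by (intro DERIV_isCont[OF has_field_derivative_powr]) auto
  then show "isCont (\<lambda>x. as_complex x powr a) x"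
    by (rule isCont_o2[rotated]) (rule bounded_linear.isCont[OF bounded_linear_as_complex continuous_ident])
qed

text \<open>The half disc avoids the branch cut along the nonpositive real axis, so the complex
  power is differentiable there and the chain rule applies.\<close>

lemma C1_on_cyl_wave:
  assumes "\<omega> > 0"
  shows "C1_on half_disc (cyl_wave \<mu> \<omega>) (cyl_wave_deriv \<mu> \<omega>)"
  unfolding C1_on_def
proof (intro conjI ballI allI)
  fix x assume x: "x \<in> half_disc"
  define c where "c = (\<omega> / 2)\<^sup>2"
  have 1: "(as_complex has_derivative as_complex) (at x)" using bounded_linear_as_complex by (rule bounded_linear_imp_has_derivative)
  have "((\<lambda>z. z powr of_real \<mu>) has_field_derivative of_real \<mu> * as_complex x powr (of_real \<mu> - 1)) (at (as_complex x))"
    using as_complex_half_disc[OF x] by (intro has_field_derivative_powr) auto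
  from has_derivative_compose[OF 1 this[unfolded has_field_derivative_def]]
  have 2: "((\<lambda>x. as_complex x powr of_real \<mu>) has_derivative (\<lambda>h. of_real \<mu> * as_complex x powr of_real (\<mu> - 1) * as_complex h)) (at x)"
    by simp
  have "((\<lambda>x::point. c * (x \<bullet> x)) has_derivative (\<lambda>h. c * (2 * (x \<bullet> h)))) (at x)"
    by (auto intro!: derivative_eq_intros simp: inner_commute)
  then have 3: "((\<lambda>x::point. c * (norm x)\<^sup>2) has_derivative (\<lambda>h. 2 * c * (x \<bullet> h))) (at x)"
    by (simp add: power2_norm_eq_inner mult_ac)
  from has_derivative_compose[OF 3 bessel_series_deriv[unfolded has_field_derivative_def]]
  have 4: "((\<lambda>x. bessel_series \<mu> (c * (norm x)\<^sup>2)) has_derivative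
      (\<lambda>h. - bessel_series (\<mu> + 1) (c * (norm x)\<^sup>2) * (2 * c * (x \<bullet> h)))) (at x)" .
  have 5: "((\<lambda>x. complex_of_real (bessel_series \<mu> (c * (norm x)\<^sup>2))) has_derivative
      (\<lambda>h. of_real (- bessel_series (\<mu> + 1) (c * (norm x)\<^sup>2) * (2 * c * (x \<bullet> h))))) (at x)"
    by (rule bounded_linear.has_derivative[OF bounded_linear_of_real 4])
  from has_derivative_mult_right[OF has_derivative_mult[OF 2 5], of "of_real ((\<omega> / 2) powr \<mu>)"]
  have "((\<lambda>x. of_real ((\<omega> / 2) powr \<mu>) * (as_complex x powr of_real \<mu> * of_real (bessel_series \<mu> (c * (norm x)\<^sup>2)))) has_derivative cyl_wave_deriv \<mu> \<omega> x) (at x)"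
    by (rule back_subst[where P = "\<lambda>d. (_ has_derivative d) _"]) (auto simp: cyl_wave_deriv_def c_def algebra_simps)
  then show "(cyl_wave \<mu> \<omega> has_derivative cyl_wave_deriv \<mu> \<omega> x) (at x)"
    by (rule has_derivative_transform_within_open[OF _ open_half_disc x]) (simp add: cyl_wave_eq assms c_def)
next
  fix h
  show "continuous_on half_disc (\<lambda>x. cyl_wave_deriv \<mu> \<omega> x h)"
    unfolding cyl_wave_deriv_def by (intro continuous_intros continuous_on_as_complex_powr)
qed

lemma norm_as_complex_powr:
  "x \<in> half_disc \<Longrightarrow> norm (as_complex x powr of_real a) = norm x powr a"
  using as_complex_half_disc[of x] by (simp add: powr_real_polar norm_mult as_complex_simps)

lemma bessel_series_bounded:
  obtains G where "G \<ge> 0" "\<And>x::point. norm x < 1 \<Longrightarrow> \<bar>bessel_series \<mu> (c * (norm x)\<^sup>2)\<bar> \<le> G"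
proof -
  have "compact ((\<lambda>t. bessel_series \<mu> (c * t\<^sup>2)) ` {0..1})"
    by (intro compact_continuous_image continuous_intros) auto
  then obtain G where "G > 0" "\<And>y. y \<in> (\<lambda>t. bessel_series \<mu> (c * t\<^sup>2)) ` {0..1} \<Longrightarrow> norm y \<le> G"
    using compact_imp_bounded bounded_pos by metis
  then show ?thesis by (intro that[of G]) auto
qed

text \<open>The derivative has one term of order \<open>r powr (\<mu> - 1)\<close> and one of order
  \<open>r powr \<mu>\<close>. For \<open>r < 1\<close> and \<open>\<mu> \<ge> 1/2\<close> both are
  at most a constant times \<open>r powr (-1/2)\<close>.\<close>

lemma cyl_wave_bounds:
  assumes \<omega>: "\<omega> > 0" and \<mu>: "\<mu> \<ge> 1/2"
  shows "\<exists>C. \<forall>x\<in>half_disc. norm (cyl_wave \<mu> \<omega> x) \<le> C \<and>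
    (\<forall>b\<in>Basis. norm (cyl_wave_deriv \<mu> \<omega> x b) \<le> C * norm x powr (-1/2))"
proof -
  define K where "K = (\<omega> / 2) powr \<mu>"
  define c where "c = (\<omega> / 2)\<^sup>2"
  have K: "K \<ge> 0" and c: "c \<ge> 0" by (auto simp: K_def c_def)
  obtain G where G: "G \<ge> 0" "\<And>x::point. norm x < 1 \<Longrightarrow> \<bar>bessel_series \<mu> (c * (norm x)\<^sup>2)\<bar> \<le> G"
    using bessel_series_bounded by blast
  obtain G' where G': "G' \<ge> 0" "\<And>x::point. norm x < 1 \<Longrightarrow> \<bar>bessel_series (\<mu> + 1) (c * (norm x)\<^sup>2)\<bar> \<le> G'"
    using bessel_series_bounded by blast
  \<comment> \<open>The summands bound, in turn, the wave itself and the two terms of its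
    derivative.\<close>
  define C where "C = K * (G + \<mu> * G + G' * (2 * c))"
  have C: "K * G \<le> C" "K * (\<mu> * G + G' * (2 * c)) \<le> C"
    unfolding C_def using K c G(1) G'(1) \<mu> by (auto intro!: mult_left_mono)
  have "norm (cyl_wave \<mu> \<omega> x) \<le> C \<and> (\<forall>b\<in>Basis. norm (cyl_wave_deriv \<mu> \<omega> x b) \<le> C * norm x powr (-1/2))"
    if x: "x \<in> half_disc" for x
  proof (intro conjI ballI)
    have r: "0 < norm x" "norm x < 1" using x as_complex_half_disc by (auto simp: half_disc_eq)
    have "norm (cyl_wave \<mu> \<omega> x) = K * (norm x powr \<mu> * \<bar>bessel_series \<mu> (c * (norm x)\<^sup>2)\<bar>)"
      using x K by (simp add: cyl_wave_eq \<omega> norm_mult norm_as_complex_powr K_def c_def)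
    also have "\<dots> \<le> K * (1 * G)"
      using r \<mu> G K by (intro mult_left_mono mult_mono powr_le1) auto
    finally show "norm (cyl_wave \<mu> \<omega> x) \<le> C" using C by simp
    fix b :: point assume b: "b \<in> Basis"
    have "norm (as_complex b) = 1" using b by (simp add: as_complex_simps)
    have xb: "\<bar>x \<bullet> b\<bar> \<le> 1" using Basis_le_norm[OF b, of x] r by simp
    have "norm (cyl_wave_deriv \<mu> \<omega> x b) \<le> K * (\<mu> * norm x powr (\<mu> - 1) * \<bar>bessel_series \<mu> (c * (norm x)\<^sup>2)\<bar> +
        norm x powr \<mu> * (\<bar>bessel_series (\<mu> + 1) (c * (norm x)\<^sup>2)\<bar> * (2 * c * \<bar>x \<bullet> b\<bar>)))"
      unfolding cyl_wave_deriv_def K_def[symmetric] c_def[symmetric] norm_mult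
      using K c \<mu> x norm_as_complex_powr[OF x, of "\<mu> - 1"] norm_as_complex_powr[OF x, of "\<mu>"] \<open>norm (as_complex b) = 1\<close>
      by (intro mult_mono order_trans[OF norm_triangle_ineq4] add_mono)
         (auto simp: norm_mult abs_mult simp del: of_real_mult of_real_diff)
    also have "\<dots> \<le> K * (\<mu> * norm x powr (-1/2) * G + norm x powr (-1/2) * (G' * (2 * c * 1)))"
      using r \<mu> G G' K xb c
      by (intro mult_left_mono add_mono mult_mono powr_mono') auto
    also have "\<dots> = K * (\<mu> * G + G' * (2 * c)) * norm x powr (-1/2)" by (simp add: algebra_simps)
    also have "\<dots> \<le> C * norm x powr (-1/2)" using C by (intro mult_right_mono) auto
    finally show "norm (cyl_wave_deriv \<mu> \<omega> x b) \<le> C * norm x powr (-1/2)" .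
  qed
  then show ?thesis by blast
qed

lemma tame_cyl_wave: "\<omega> > 0 \<Longrightarrow> \<mu> \<ge> 1/2 \<Longrightarrow> tame (cyl_wave \<mu> \<omega>)"
  unfolding tame_def using C1_on_cyl_wave cyl_wave_bounds by blast

text \<open>Derivatives at points of an open set depend only on values there. This is needed because
  the forms agree with their wave expressions only on the half disc.\<close>

lemma tame_cong:
  assumes "\<And>x. x \<in> half_disc \<Longrightarrow> u x = v x" "tame u"
  shows "tame v"
proof -
  have "(v has_derivative d) (at x)" if "(u has_derivative d) (at x)" "x \<in> half_disc" for d x
    by (rule has_derivative_transform_within_open[OF that(1) open_half_disc that(2)]) (simp add: assms)
  then show ?thesis using assms unfolding tame_def C1_on_def by metis
qed

text \<open>The Bessel relations turn the radial factors of the 1-forms into sums and differences of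
  orders \<open>\<nu> - 1\<close> and \<open>\<nu> + 1\<close>. Rotating from polar to Cartesian
  components multiplies by \<open>cos \<phi>\<close> and \<open>sin \<phi>\<close>, and the addition
  theorems match the angles to exactly these orders.\<close>

lemma cyl_wave_components:
  fixes \<omega> :: real and n :: nat
  assumes x: "x \<in> half_disc" and \<omega>: "\<omega> > 0"
  defines "\<nu> \<equiv> real n - 1/2"
  shows "E20 n \<omega> x = of_real (Re (cyl_wave \<nu> \<omega> x))" (is ?E20)
    and "H21 n \<omega> x = - \<i> * of_real (Im (cyl_wave \<nu> \<omega> x))" (is ?H21)
    and "fst (H20 n \<omega> x) = \<i> / 2 * of_real (Re (cyl_wave (\<nu> - 1) \<omega> x - cyl_wave (\<nu> + 1) \<omega> x))" (is ?H1)
    and "snd (H20 n \<omega> x) = - \<i> / 2 * of_real (Im (cyl_wave (\<nu> - 1) \<omega> x + cyl_wave (\<nu> + 1) \<omega> x))" (is ?H2)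
    and "fst (E21 n \<omega> x) = - 1 / 2 * of_real (Re (cyl_wave (\<nu> - 1) \<omega> x + cyl_wave (\<nu> + 1) \<omega> x))" (is ?E1)
    and "snd (E21 n \<omega> x) = 1 / 2 * of_real (Im (cyl_wave (\<nu> - 1) \<omega> x - cyl_wave (\<nu> + 1) \<omega> x))" (is ?E2)
proof -
  define r where "r = norm x"
  define \<phi> where "\<phi> = Arg (as_complex x)"
  define A where "A = bessel_J (\<nu> - 1) (\<omega> * r)"
  define B where "B = bessel_J (\<nu> + 1) (\<omega> * r)"
  define Jn where "Jn = bessel_J \<nu> (\<omega> * r)"
  have r: "r > 0" using as_complex_half_disc[OF x] by (simp add: r_def)
  have "as_complex x = rcis r \<phi>" using rcis_cmod_Arg[of "as_complex x"] by (simp add: r_def \<phi>_def as_complex_simps)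
  then have xy: "fst x = r * cos \<phi>" "snd x = r * sin \<phi>" by (metis as_complex_simps(1) Re_rcis, metis as_complex_simps(2) Im_rcis)
  have pol: "polar f x = f r \<phi>" for f by (simp add: polar_def r_def \<phi>_def as_complex_def)
  have tr: "cos ((\<nu> - 1) * \<phi>) = cos (\<nu> * \<phi>) * cos \<phi> + sin (\<nu> * \<phi>) * sin \<phi>"
    "cos ((\<nu> + 1) * \<phi>) = cos (\<nu> * \<phi>) * cos \<phi> - sin (\<nu> * \<phi>) * sin \<phi>"
    "sin ((\<nu> - 1) * \<phi>) = sin (\<nu> * \<phi>) * cos \<phi> - cos (\<nu> * \<phi>) * sin \<phi>"
    "sin ((\<nu> + 1) * \<phi>) = sin (\<nu> * \<phi>) * cos \<phi> + cos (\<nu> * \<phi>) * sin \<phi>"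
    by (simp_all add: left_diff_distrib distrib_right cos_diff cos_add sin_diff sin_add)
  have "((\<lambda>s. bessel_J \<nu> (\<omega> * s)) has_real_derivative (A - B) / 2 * \<omega>) (at r)"
    unfolding A_def B_def
    by (rule DERIV_chain2[where f = "bessel_J \<nu>" and g = "\<lambda>s. \<omega> * s", OF bessel_J_deriv])
       (use \<omega> r in \<open>auto intro!: derivative_eq_intros\<close>)
  then have d: "inverse \<omega> * deriv (\<lambda>s. bessel_J \<nu> (\<omega> * s)) r = (A - B) / 2"
    using \<omega> by (simp add: DERIV_imp_deriv)
  have "2 * \<nu> / (\<omega> * r) * Jn = A + B"
    using bessel_J_recurrence[of "\<omega> * r" \<nu>] \<omega> r by (simp add: A_def B_def Jn_def)
  then have j: "\<nu> * inverse \<omega> * inverse r * bessel_J \<nu> (\<omega> * r) = (A + B) / 2"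
    using \<omega> r by (simp add: field_simps Jn_def)
  \<comment> \<open>Rewriting is syntactic, so the variant with \<open>- \<nu>\<close> in front, as
    it occurs in \<open>E21\<close>, gets its own equation.\<close>
  then have j': "- \<nu> * inverse \<omega> * inverse r * bessel_J \<nu> (\<omega> * r) = - (A + B) / 2"
    by simp
  have cy: "Re (cyl_wave a \<omega> x) = bessel_J a (\<omega> * r) * cos (a * \<phi>)"
     "Im (cyl_wave a \<omega> x) = bessel_J a (\<omega> * r) * sin (a * \<phi>)" for a
    by (simp_all add: cyl_wave_def r_def \<phi>_def)
  note forms = H20_def E21_def Let_def \<nu>_def[symmetric] add1_def mult1_def pol d j j' dr_def d\<phi>_def r_def[symmetric]
    fst_add snd_add fst_conv snd_conv xy
  show ?E20 by (simp add: E20_def \<nu>_def[symmetric] pol cy Let_def)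
  have "(cos \<phi>)\<^sup>2 + (sin \<phi>)\<^sup>2 = 1" by simp
  \<comment> \<open>This is the inverse Jacobian of polar coordinates; it cancels the factor
    \<open>r\<close> in \<open>H21\<close>.\<close>
  then have "wedge11 dr d\<phi> x = of_real (1 / r)"
    using r unfolding wedge11_def dr_def d\<phi>_def r_def[symmetric] xy
    by (simp add: complex_eq_iff field_simps power2_eq_square power3_eq_cube)
  then show ?H21 using r by (simp add: H21_def \<nu>_def[symmetric] pol cy Let_def mult2_def)
  show ?H1 unfolding forms minus_complex.sel plus_complex.sel cy tr A_def[symmetric] B_def[symmetric]
    using r by (simp add: complex_eq_iff power2_eq_square) (simp add: field_simps)
  show ?H2 unfolding forms minus_complex.sel plus_complex.sel cy tr A_def[symmetric] B_def[symmetric]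
    using r by (simp add: complex_eq_iff power2_eq_square) (simp add: field_simps)
  show ?E1 unfolding forms minus_complex.sel plus_complex.sel cy tr A_def[symmetric] B_def[symmetric]
    using r by (simp add: complex_eq_iff power2_eq_square) (simp add: field_simps)
  show ?E2 unfolding forms minus_complex.sel plus_complex.sel cy tr A_def[symmetric] B_def[symmetric]
    using r by (simp add: complex_eq_iff power2_eq_square) (simp add: field_simps)
qed

text \<open>The 0-form and the 2-form involve only the order \<open>\<nu> \<ge> 1/2\<close>. The
  1-forms also involve \<open>\<nu> - 1\<close>, which reaches 1/2 exactly when
  \<open>n \<ge> 2\<close>.\<close>

lemma
  fixes n :: nat
  assumes "\<omega> > 0" and "n \<ge> 1"
  shows E20_H1: "E20 n \<omega> \<in> H1 half_disc"
    and H21_H1: "H21 n \<omega> \<in> H1 half_disc"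
    and H20_H1: "n \<noteq> 1 \<Longrightarrow> components1 (H20 n \<omega>) \<subseteq> H1 half_disc"
    and E21_H1: "n \<noteq> 1 \<Longrightarrow> components1 (E21 n \<omega>) \<subseteq> H1 half_disc"
proof -
  define \<nu> where "\<nu> = real n - 1/2"
  note cc = cyl_wave_components[OF _ assms(1), of _ n, folded \<nu>_def]
  have lin: "bounded_linear (\<lambda>z. a * complex_of_real (Re z))" "bounded_linear (\<lambda>z. a * complex_of_real (Im z))" for a
    by (intro bounded_linear_const_mult bounded_linear_compose[OF bounded_linear_of_real] bounded_linear_Re bounded_linear_Im)+
  have c: "tame (cyl_wave \<nu> \<omega>)" using assms by (intro tame_cyl_wave) (auto simp: \<nu>_def)
  have p: "tame (\<lambda>x. of_real (Re (cyl_wave \<nu> \<omega> x)))"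
    using tame_bounded_linear[OF c lin(1)[of 1]] by simp
  show "E20 n \<omega> \<in> H1 half_disc"
    by (rule tame_imp_H1[OF tame_cong[OF _ p]]) (simp add: cc)
  show "H21 n \<omega> \<in> H1 half_disc"
    by (rule tame_imp_H1[OF tame_cong[OF _ tame_bounded_linear[OF c lin(2)[of "- \<i>"]]]]) (simp add: cc)
  assume "n \<noteq> 1"
  then have t: "tame (cyl_wave (\<nu> - 1) \<omega>)" "tame (cyl_wave (\<nu> + 1) \<omega>)"
    using assms by (auto intro!: tame_cyl_wave simp: \<nu>_def)
  have add: "tame (\<lambda>x. cyl_wave (\<nu> - 1) \<omega> x + cyl_wave (\<nu> + 1) \<omega> x)"
    using t by (rule tame_add)
  have diff: "tame (\<lambda>x. cyl_wave (\<nu> - 1) \<omega> x - cyl_wave (\<nu> + 1) \<omega> x)"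
    using tame_add[OF t(1) tame_bounded_linear[OF t(2) bounded_linear_minus[OF bounded_linear_ident]]] by simp
  note T = tame_imp_H1[OF tame_cong[OF _ tame_bounded_linear]]
  have "(\<lambda>x. fst (H20 n \<omega> x)) \<in> H1 half_disc"
    by (rule T[OF _ diff lin(1)[of "\<i> / 2"]]) (simp add: cc)
  moreover have "(\<lambda>x. snd (H20 n \<omega> x)) \<in> H1 half_disc"
    by (rule T[OF _ add lin(2)[of "- \<i> / 2"]]) (simp add: cc)
  moreover have "(\<lambda>x. fst (E21 n \<omega> x)) \<in> H1 half_disc"
    by (rule T[OF _ add lin(1)[of "- 1 / 2"]]) (simp add: cc)
  moreover have "(\<lambda>x. snd (E21 n \<omega> x)) \<in> H1 half_disc"
    by (rule T[OF _ diff lin(2)[of "1 / 2"]]) (simp add: cc)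
  ultimately show "components1 (H20 n \<omega>) \<subseteq> H1 half_disc" "components1 (E21 n \<omega>) \<subseteq> H1 half_disc"
    by (auto simp: components1_def)
qed

subsection \<open>Smooth bump functions\<close>

text \<open>Lets an explicit derivative formula stand in for \<open>frechet_derivative\<close>, by
  uniqueness of derivatives.\<close>

lemma Ck_SucI:
  assumes "\<And>x. (f has_derivative f' x) (at x)" "\<And>b. b \<in> Basis \<Longrightarrow> Ck k (\<lambda>x. f' x b)"
  shows "Ck (Suc k) f"
proof -
  have "frechet_derivative f (at x) = f' x" for x using assms(1) by (metis frechet_derivative_at)
  then show ?thesis using assms by (auto simp: differentiable_on_def differentiable_def intro: has_derivative_at_withinI)
qed

lemma Ck_SucD:
  assumes "Ck (Suc k) f"
  shows "(f has_derivative frechet_derivative f (at x)) (at x)"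
    and "b \<in> Basis \<Longrightarrow> Ck k (\<lambda>x. frechet_derivative f (at x) b)"
  using assms by (simp_all add: differentiable_on_def frechet_derivative_works)

lemma Ck_Suc_imp_Ck: "Ck (Suc k) f \<Longrightarrow> Ck k f"
proof (induction k arbitrary: f)
  case 0
  then show ?case by (simp add: differentiable_imp_continuous_on)
next
  case (Suc k)
  show ?case by (rule Ck_SucI[OF Ck_SucD(1)[OF Suc.prems] Suc.IH[OF Ck_SucD(2)[OF Suc.prems]]])
qed

lemma Ck_const: "Ck k (\<lambda>_. c)"
  by (induction k arbitrary: c) (auto intro!: Ck_SucI[OF has_derivative_const] simp del: Ck.simps(2))

lemma Ck_add: "Ck k f \<Longrightarrow> Ck k g \<Longrightarrow> Ck k (\<lambda>x. f x + g x)"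
proof (induction k arbitrary: f g)
  case (Suc k)
  note D = Ck_SucD[OF Suc.prems(1)] Ck_SucD[OF Suc.prems(2)]
  show ?case by (rule Ck_SucI[OF has_derivative_add[OF D(1,3)]]) (rule Suc.IH[OF D(2,4)])
qed (simp add: continuous_on_add)

lemma Ck_mult: "Ck k f \<Longrightarrow> Ck k g \<Longrightarrow> Ck k (\<lambda>x. f x * g x)"
proof (induction k arbitrary: f g)
  case (Suc k)
  note D = Ck_SucD[OF Suc.prems(1)] Ck_SucD[OF Suc.prems(2)]
  note C = Suc.prems[THEN Ck_Suc_imp_Ck]
  show ?case by (rule Ck_SucI[OF has_derivative_mult[OF D(1,3)]]) (intro Ck_add Suc.IH C D(2,4))
qed (simp add: continuous_on_mult)

lemma Ck_affine: "Ck k (\<lambda>x. a + x \<bullet> v)"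
proof (cases k)
  case (Suc m)
  show ?thesis unfolding Suc
    by (rule Ck_SucI[where f' = "\<lambda>_ h. h \<bullet> v"]) (auto intro!: derivative_eq_intros Ck_const)
qed (auto intro!: continuous_intros)

text \<open>For \<open>k = 0\<close> this is the classical smooth function
  \<open>exp (- 1/t)\<close>, continued by zero. The powers of \<open>1 / t\<close> make the family
  closed, up to linear combinations, under differentiation.\<close>

definition flat :: "nat \<Rightarrow> real \<Rightarrow> real" where
  "flat k t = (if t > 0 then (1 / t) ^ k * exp (- (1 / t)) else 0)"

lemma flat_deriv:
  "(flat k has_real_derivative flat (k + 2) t - real k * flat (k + 1) t) (at t)"
proof -
  consider "t > 0" | "t < 0" | "t = 0" by linarith
  then show ?thesis
  proof cases
    case 1
    have "((\<lambda>t. (1 / t) ^ k * exp (- (1 / t))) has_real_derivative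
        (real k * (1 / t) ^ (k - 1) * (- 1 / t\<^sup>2)) * exp (- (1 / t)) + exp (- (1 / t)) * (1 / t\<^sup>2) * (1 / t) ^ k) (at t)"
      using 1 by (auto intro!: derivative_eq_intros simp: power2_eq_square)
    moreover have "(real k * (1 / t) ^ (k - 1) * (- 1 / t\<^sup>2)) * exp (- (1 / t)) + exp (- (1 / t)) * (1 / t\<^sup>2) * (1 / t) ^ k
        = flat (k + 2) t - real k * flat (k + 1) t"
      using 1 by (cases k) (auto simp: flat_def power2_eq_square field_simps)
    ultimately have "((\<lambda>t. (1 / t) ^ k * exp (- (1 / t))) has_real_derivative flat (k + 2) t - real k * flat (k + 1) t) (at t)"
      by simp
    then show ?thesis
      by (rule has_field_derivative_transform_within_open[where S = "{0<..}"]) (use 1 in \<open>auto simp: flat_def\<close>)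
  next
    case 2
    have "(flat k has_real_derivative 0) (at t)"
      by (rule has_field_derivative_transform_within_open[OF DERIV_const, where S = "{..<0}"]) (use 2 in \<open>auto simp: flat_def\<close>)
    then show ?thesis using 2 by (simp add: flat_def)
  next
    case 3
    \<comment> \<open>For \<open>h > 0\<close> the difference quotient at the origin is
      \<open>u ^ Suc k * exp (- u)\<close> with \<open>u = inverse h\<close>, and the exponential
      beats every power as \<open>u\<close> grows.\<close>
    have "((\<lambda>h. inverse h ^ Suc k / exp (inverse h)) \<longlongrightarrow> 0) (at_right (0::real))"
      by (rule filterlim_compose[OF tendsto_power_div_exp_0 filterlim_inverse_at_top_right])
    then have "((\<lambda>h. flat k h / h) \<longlongrightarrow> 0) (at_right 0)"
      by (rule Lim_transform_eventually)
         (auto simp: eventually_at_filter flat_def exp_minus field_simps)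
    moreover have "((\<lambda>h. flat k h / h) \<longlongrightarrow> 0) (at_left 0)"
      by (rule Lim_transform_eventually[OF tendsto_const]) (auto simp: eventually_at_filter flat_def)
    ultimately have "((\<lambda>h. flat k h / h) \<longlongrightarrow> 0) (at 0)" by (simp add: filterlim_at_split)
    then show ?thesis using 3 by (simp add: DERIV_def flat_def)
  qed
qed

lemma flat_nonneg: "flat k t \<ge> 0"
  by (simp add: flat_def)

text \<open>Dilation by \<open>s\<close> moves a fixed profile to the ball around
  \<open>p /\<^sub>R s\<close> of radius \<open>\<rho> / s\<close> without changing its height. The
  inner product keeps the argument of \<open>flat\<close> polynomial in \<open>x\<close>.\<close>

definition bump :: "'a::euclidean_space \<Rightarrow> real \<Rightarrow> real \<Rightarrow> 'a \<Rightarrow> real" where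
  "bump p \<rho> s x = flat 0 (\<rho>\<^sup>2 - (s *\<^sub>R x - p) \<bullet> (s *\<^sub>R x - p))"

text \<open>Induction on \<open>m\<close> for all \<open>k\<close> at once, since each derivative
  raises the index of \<open>flat\<close>.\<close>

lemma Ck_flat_bump: "Ck m (\<lambda>x. flat k (\<rho>\<^sup>2 - (s *\<^sub>R x - p) \<bullet> (s *\<^sub>R x - p)))"
proof (induction m arbitrary: k)
  case 0
  have "continuous_on UNIV (flat k)"
    by (auto intro!: continuous_at_imp_continuous_on DERIV_isCont[OF flat_deriv])
  then show ?case by (auto intro!: continuous_intros continuous_on_compose2[of UNIV "flat k"])
next
  case (Suc m)
  let ?q = "\<lambda>x. \<rho>\<^sup>2 - (s *\<^sub>R x - p) \<bullet> (s *\<^sub>R x - p)"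
  \<comment> \<open>Written so that, for a fixed direction, the derivative is visibly affine in
    \<open>x\<close> and fits \<open>Ck_affine\<close>.\<close>
  have q: "(?q has_derivative (\<lambda>h. 2 * s * (p \<bullet> h) + x \<bullet> ((- 2 * s\<^sup>2) *\<^sub>R h))) (at x)" for x
    by (auto intro!: derivative_eq_intros simp: inner_commute algebra_simps power2_eq_square fun_eq_iff)
  show ?case
  proof (rule Ck_SucI)
    show "((\<lambda>x. flat k (?q x)) has_derivative
        (\<lambda>h. (flat (k + 2) (?q x) + - real k * flat (k + 1) (?q x)) * (2 * s * (p \<bullet> h) + x \<bullet> ((- 2 * s\<^sup>2) *\<^sub>R h)))) (at x)" for x
      using has_derivative_compose[OF q flat_deriv[unfolded has_field_derivative_def]] by simp
    show "Ck m (\<lambda>x. (flat (k + 2) (?q x) + - real k * flat (k + 1) (?q x)) * (2 * s * (p \<bullet> b) + x \<bullet> ((- 2 * s\<^sup>2) *\<^sub>R b)))" for b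
      by (intro Ck_mult Ck_add Ck_affine Ck_const Suc.IH)
  qed
qed

lemma cball_scaled:
  fixes p :: "'a::real_normed_vector"
  assumes "s > 0"
  shows "x \<in> cball (p /\<^sub>R s) (\<rho> / s) \<longleftrightarrow> norm (s *\<^sub>R x - p) \<le> \<rho>"
proof -
  have "s *\<^sub>R x - p = s *\<^sub>R (x - p /\<^sub>R s)" using assms by (simp add: algebra_simps)
  then have "norm (s *\<^sub>R x - p) = s * dist (p /\<^sub>R s) x" using assms by (simp add: dist_norm norm_minus_commute)
  then show ?thesis using assms by (simp add: field_simps)
qed

lemma bump_eq_0:
  assumes "s > 0" "\<rho> > 0" "x \<notin> cball (p /\<^sub>R s) (\<rho> / s)"
  shows "bump p \<rho> s x = 0"
proof -
  have "\<rho> < norm (s *\<^sub>R x - p)" using assms cball_scaled[of s x p \<rho>] by auto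
  then have "\<rho>\<^sup>2 \<le> (norm (s *\<^sub>R x - p))\<^sup>2" using assms by (intro power_mono) auto
  then show ?thesis by (simp add: bump_def flat_def power2_norm_eq_inner)
qed

lemma bump_nonneg: "bump p \<rho> s x \<ge> 0"
  by (simp add: bump_def flat_nonneg)

lemma bump_le_1: "bump p \<rho> s x \<le> 1"
  by (simp add: bump_def flat_def)

text \<open>On the ball of half the radius the argument of \<open>flat\<close> is at least
  \<open>\<rho>\<^sup>2 / 2\<close>. The resulting lower bound does not depend on
  \<open>s\<close>.\<close>

lemma bump_ge:
  assumes "s > 0" "\<rho> > 0" "x \<in> cball (p /\<^sub>R s) (\<rho> / 2 / s)"
  shows "exp (- (2 / \<rho>\<^sup>2)) \<le> bump p \<rho> s x"
proof -
  define t where "t = \<rho>\<^sup>2 - (norm (s *\<^sub>R x - p))\<^sup>2"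
  have "norm (s *\<^sub>R x - p) \<le> \<rho> / 2" using assms cball_scaled[of s x p "\<rho> / 2"] by simp
  then have "(norm (s *\<^sub>R x - p))\<^sup>2 \<le> (\<rho> / 2)\<^sup>2" by (intro power_mono) auto
  then have "4 * (norm (s *\<^sub>R x - p))\<^sup>2 \<le> \<rho>\<^sup>2" by (simp add: power_divide)
  then have "\<rho>\<^sup>2 / 2 \<le> t"
    using zero_le_power2[of "norm (s *\<^sub>R x - p)"] unfolding t_def by linarith
  moreover from this have "t > 0" using assms by (intro less_le_trans[of 0 "\<rho>\<^sup>2 / 2" t]) auto
  ultimately have "1 / t \<le> 2 / \<rho>\<^sup>2" using assms by (simp add: field_simps)
  then show ?thesis using \<open>t > 0\<close> by (simp add: bump_def flat_def t_def power2_norm_eq_inner)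
qed

lemma test_function_bump:
  assumes "s > 0" "\<rho> > 0" "cball (p /\<^sub>R s) (\<rho> / s) \<subseteq> S"
  shows "test_function S (bump p \<rho> s)"
proof -
  have "{x. bump p \<rho> s x \<noteq> 0} \<subseteq> cball (p /\<^sub>R s) (\<rho> / s)" using bump_eq_0[OF assms(1,2)] by blast
  then have c: "closure {x. bump p \<rho> s x \<noteq> 0} \<subseteq> cball (p /\<^sub>R s) (\<rho> / s)" by (rule closure_minimal) simp
  then have "compact (closure {x. bump p \<rho> s x \<noteq> 0})"
    by (meson bounded_cball bounded_subset closed_closure compact_eq_bounded_closed)
  then show ?thesis using c assms(3) Ck_flat_bump[of _ 0 \<rho> s p]
    by (auto simp: test_function_def bump_def[abs_def])
qed

subsection \<open>Failure of square integrability for \<open>n = 1\<close>\<close>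

text \<open>In polar terms \<open>cos \<phi> > 0\<close> and \<open>sin \<phi> \<ge> 1/4\<close>. On
  these angles \<open>sin (3/2 * \<phi>)\<close> stays above a positive constant.\<close>

definition sector :: "point set" where
  "sector = {x. 0 < fst x \<and> norm x \<le> 4 * snd x}"

text \<open>After dilation by \<open>s\<close> the ball has centre \<open>(1/2, 1/2)\<close> and
  radius 1/4. Both coordinates are then at least 1/4, and the norm is below 3/4 + 1/4 = 1.\<close>

lemma cball_in_sector:
  fixes x :: point
  assumes "s \<ge> 1" and "x \<in> cball ((1/2, 1/2) /\<^sub>R s) (1 / 4 / s)"
  shows "x \<in> half_disc" "x \<in> sector" "norm x \<le> 1 / s"
proof -
  obtain a b where x: "x = (a, b)" by fastforce
  define A where "A = s * a"
  define B where "B = s * b"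
  have s: "s > 0" using assms by simp
  have n: "norm (A - 1/2, B - 1/2) \<le> 1 / 4"
    using cball_scaled[OF s, of x "(1/2, 1/2)" "1/4"] assms(2) by (simp add: x A_def B_def)
  have "\<bar>A - 1/2\<bar> \<le> 1 / 4" "\<bar>B - 1/2\<bar> \<le> 1 / 4"
    using order_trans[OF norm_fst_le n] order_trans[OF norm_snd_le n] by simp_all
  then have AB: "1 / 4 \<le> A" "1 / 4 \<le> B" by linarith+
  have "(norm (1/2 :: real, 1/2 :: real))\<^sup>2 = 1 / 2" by (simp add: norm_Pair power2_eq_square)
  also have "\<dots> < (3 / 4)\<^sup>2" by (simp add: power2_eq_square)
  finally have "norm (1/2 :: real, 1/2 :: real) < 3 / 4" by (rule power2_less_imp_less) simp
  moreover have "norm (A, B) \<le> norm (A - 1/2, B - 1/2) + norm (1/2 :: real, 1/2 :: real)"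
    using norm_triangle_ineq[of "(A - 1/2, B - 1/2)" "(1/2 :: real, 1/2 :: real)"] by simp
  moreover have "norm (A, B) = s * norm x" using s norm_scaleR[of s x] by (simp add: x A_def B_def)
  ultimately have r: "s * norm x < 1" using n by linarith
  then have "norm x < 1 / s" using s by (simp add: field_simps)
  then show "norm x \<le> 1 / s" by simp
  have ab: "1 / (4 * s) \<le> a" "1 / (4 * s) \<le> b" using AB s by (auto simp: A_def B_def field_simps)
  then have "0 < a" "0 < b" using s by (auto intro: less_le_trans[of 0 "1 / (4 * s)"])
  moreover have "1 / s \<le> 1" using assms by simp
  ultimately show "x \<in> half_disc" using \<open>norm x < 1 / s\<close> by (simp add: half_disc_eq x)
  have "norm x \<le> 4 * b" using \<open>norm x < 1 / s\<close> ab(2) by simp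
  then show "x \<in> sector" using \<open>0 < a\<close> by (simp add: sector_def x)
qed

lemma measure_cball_half_disc:
  fixes c :: point
  assumes "cball c r \<subseteq> half_disc" "r \<ge> 0"
  shows "integrable (lebesgue_on half_disc) (indicator (cball c r) :: point \<Rightarrow> real)"
    and "integral\<^sup>L (lebesgue_on half_disc) (indicator (cball c r)) = unit_ball_vol 2 * r\<^sup>2"
proof -
  have hd: "half_disc \<in> sets lebesgue" using open_half_disc by auto
  have "integrable lborel (indicator (cball c r) :: point \<Rightarrow> real)"
    using assms(2) by (simp add: emeasure_cball)
  then have i: "integrable lebesgue (indicator (cball c r) :: point \<Rightarrow> real)"
    by (subst integrable_completion) auto
  have eq: "(\<lambda>x. indicator half_disc x *\<^sub>R indicator (cball c r) x) = (indicator (cball c r) :: point \<Rightarrow> real)"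
    using assms(1) by (auto simp: indicator_def fun_eq_iff)
  show "integrable (lebesgue_on half_disc) (indicator (cball c r) :: point \<Rightarrow> real)"
    using hd i by (simp only: integrable_restrict_space sets.Int_space_eq2 eq)
  have "integral\<^sup>L (lebesgue_on half_disc) (indicator (cball c r)) = integral\<^sup>L lebesgue (indicator (cball c r) :: point \<Rightarrow> real)"
    using hd integral_restrict_space[of half_disc lebesgue "indicator (cball c r) :: point \<Rightarrow> real"]
    by (simp only: eq sets.Int_space_eq2)
  also have "\<dots> = measure lborel (cball c r)" by simp
  also have "\<dots> = unit_ball_vol 2 * r\<^sup>2"
    using assms(2) by (simp add: measure_def emeasure_cball power2_eq_square)
  finally show "integral\<^sup>L (lebesgue_on half_disc) (indicator (cball c r)) = unit_ball_vol 2 * r\<^sup>2" .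
qed

text \<open>A weak derivative \<open>g\<close> and the classical \<open>u'\<close> have the same
  pairings with test functions. Against a bump at scale \<open>1 / s\<close>, the lower bound on
  \<open>u'\<close> gives order \<open>s powr (3/2)\<close> times an area of order
  \<open>1 / s\<^sup>2\<close>, while \<open>g\<close> in \<open>L2\<close> allows only
  \<open>O(1/s)\<close>. The factor \<open>a\<close> turns the singular direction into the positive
  real axis.\<close>

lemma not_H1_if_singular:
  assumes u: "C1_on half_disc u u'" and c: "c > 0" and \<delta>: "\<delta> > 0"
    and low: "\<And>x. x \<in> half_disc \<Longrightarrow> x \<in> sector \<Longrightarrow> norm x < \<delta> \<Longrightarrow> c * norm x powr (-3/2) \<le> Re (a * u' x (0, 1))"
  shows "u \<notin> H1 half_disc"
proof
  assume "u \<in> H1 half_disc"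
  have b: "(0, 1) \<in> (Basis :: point set)" by (simp add: Basis_prod_def)
  with \<open>u \<in> H1 half_disc\<close> obtain g where g: "g \<in> L2 half_disc" "weak_partial half_disc (0, 1) u g"
    by (auto simp: H1_def)
  note g' = C1_imp_weak_partial[OF open_half_disc u b]
  let ?M = "lebesgue_on half_disc"
  define p :: point where "p = (1/2, 1/2)"
  define v where "v = unit_ball_vol 2"
  define N where "N = integral\<^sup>L ?M (\<lambda>x. (norm (g x))\<^sup>2)"
  have gi: "integrable ?M (\<lambda>x. (norm (g x))\<^sup>2)" and gm: "g \<in> borel_measurable ?M" using g by (auto simp: L2_def)
  define m where "m = exp (- (2 / (1/4)\<^sup>2) :: real)"
  have v: "v > 0" and m: "m > 0" by (auto simp: v_def m_def)
  \<comment> \<open>Here \<open>v / (64 * s\<^sup>2)\<close> is the area of the inner ball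
    \<open>K'\<close>, where the bump is at least \<open>m\<close>. On the right,
    \<open>v / 16\<close> stems from the area of the supporting ball \<open>K\<close>, and
    \<open>N\<close> is the squared norm of \<open>g\<close>.\<close>
  have main: "c * s powr (3/2) * (m * (v / (64 * s\<^sup>2))) \<le> norm a * ((v / 16 + N) / (2 * s))"
    if s: "s \<ge> 1" "s > 1 / \<delta>" for s
  proof -
    define K where "K = cball (p /\<^sub>R s) (1 / 4 / s)"
    define K' where "K' = cball (p /\<^sub>R s) (1 / 4 / 2 / s)"
    define \<psi> where "\<psi> = bump p (1/4) s"
    have s0: "s > 0" using s by simp
    note S = cball_in_sector[OF s(1), folded p_def, folded K_def]
    have K: "K \<subseteq> half_disc" using S(1) by blast
    have "K' \<subseteq> K" using s0 unfolding K_def K'_def by (intro subset_cball) (simp add: field_simps)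
    then have K': "K' \<subseteq> half_disc" using K by blast
    have t: "test_function half_disc \<psi>"
      using K s0 unfolding \<psi>_def K_def by (intro test_function_bump) auto
    have \<psi>0: "\<psi> x = 0" if "x \<notin> K" for x
      using that s0 bump_eq_0[of s "1/4" x p] by (simp add: \<psi>_def K_def)
    have \<psi>: "0 \<le> \<psi> x" "\<psi> x \<le> 1" for x by (auto simp: \<psi>_def bump_nonneg bump_le_1)
    have \<psi>m: "m \<le> \<psi> x" if "x \<in> K'" for x
      using that s0 unfolding m_def \<psi>_def K'_def by (intro bump_ge) auto
    note \<psi>c = test_function_C1(3)[OF t]
    have comp: "compact K" by (simp add: K_def)
    note int = integrable_continuous_compact_support(1)[OF _ comp K borel_open[OF open_half_disc]]
    have i1: "integrable ?M \<psi>" by (rule int) (use \<psi>0 in \<open>auto intro: continuous_on_subset[OF \<psi>c]\<close>)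
    have i2: "integrable ?M (\<lambda>x. \<psi> x *\<^sub>R u' x (0, 1))"
    proof (rule int)
      have "continuous_on half_disc (\<lambda>x. u' x (0, 1))" using u by (simp only: C1_on_def)
      then show "continuous_on half_disc (\<lambda>x. \<psi> x *\<^sub>R u' x (0, 1))"
        by (intro continuous_intros continuous_on_subset[OF \<psi>c]) auto
    qed (use \<psi>0 in auto)
    have iK: "integrable ?M (indicator K :: point \<Rightarrow> real)" "integral\<^sup>L ?M (indicator K) = v * (1 / 4 / s)\<^sup>2"
      using K s0 measure_cball_half_disc[of "p /\<^sub>R s" "1 / 4 / s"] by (auto simp: K_def v_def)
    have iK': "integrable ?M (indicator K' :: point \<Rightarrow> real)" "integral\<^sup>L ?M (indicator K') = v * (1 / 4 / 2 / s)\<^sup>2"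
      using K' s0 measure_cball_half_disc[of "p /\<^sub>R s" "1 / 4 / 2 / s"] by (auto simp: K'_def v_def)
    have "m * (v / (64 * s\<^sup>2)) = integral\<^sup>L ?M (\<lambda>x. m * indicator K' x)"
      using iK' s0 by (simp add: power_divide power_mult_distrib)
    also have "\<dots> \<le> integral\<^sup>L ?M \<psi>"
    proof (intro integral_mono)
      show "integrable ?M (\<lambda>x. m * indicator K' x)" using iK' by simp
      show "m * indicator K' x \<le> \<psi> x" for x using \<psi> \<psi>m by (cases "x \<in> K'") auto
    qed (rule i1)
    finally have "c * s powr (3/2) * (m * (v / (64 * s\<^sup>2))) \<le> c * s powr (3/2) * integral\<^sup>L ?M \<psi>"
      using c by (intro mult_left_mono) auto
    also have "\<dots> = integral\<^sup>L ?M (\<lambda>x. c * s powr (3/2) * \<psi> x)" by simp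
    also have "\<dots> \<le> integral\<^sup>L ?M (\<lambda>x. Re (a * (\<psi> x *\<^sub>R u' x (0, 1))))"
    proof (intro integral_mono)
      show "integrable ?M (\<lambda>x. c * s powr (3/2) * \<psi> x)" using i1 by simp
      show "integrable ?M (\<lambda>x. Re (a * (\<psi> x *\<^sub>R u' x (0, 1))))"
        by (intro integrable_Re integrable_mult_right i2)
      fix x assume "x \<in> space ?M"
      show "c * s powr (3/2) * \<psi> x \<le> Re (a * (\<psi> x *\<^sub>R u' x (0, 1)))"
      proof (cases "x \<in> K")
        case True
        have n: "norm x \<le> 1 / s" "norm x > 0" using S[OF True] as_complex_half_disc by auto
        have "1 / s < \<delta>" using s s0 \<delta> by (simp add: field_simps)
        then have "norm x < \<delta>" using n by simp
        have "s powr (3/2) = (1 / s) powr (-3/2)" using s0 by (simp add: powr_divide powr_minus_divide)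
        also have "\<dots> \<le> norm x powr (-3/2)" using n by (intro powr_mono2') auto
        finally have "c * s powr (3/2) \<le> c * norm x powr (-3/2)" using c by simp
        also have "\<dots> \<le> Re (a * u' x (0, 1))" using low[OF S(1,2)[OF True] \<open>norm x < \<delta>\<close>] .
        finally have "c * s powr (3/2) * \<psi> x \<le> Re (a * u' x (0, 1)) * \<psi> x"
          using \<psi> by (intro mult_right_mono) auto
        then show ?thesis by (simp add: algebra_simps)
      qed (simp add: \<psi>0)
    qed
    also have "\<dots> = Re (a * integral\<^sup>L ?M (\<lambda>x. \<psi> x *\<^sub>R u' x (0, 1)))"
    proof -
      have ia: "integrable ?M (\<lambda>x. a * (\<psi> x *\<^sub>R u' x (0, 1)))"
        by (intro integrable_mult_right i2)
      have "integral\<^sup>L ?M (\<lambda>x. a * (\<psi> x *\<^sub>R u' x (0, 1))) = a * integral\<^sup>L ?M (\<lambda>x. \<psi> x *\<^sub>R u' x (0, 1))"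
        by (rule integral_mult_right_zero)
      with integral_Re[OF ia] show ?thesis by (rule trans[OF _ arg_cong[where f = Re]])
    qed
    \<comment> \<open>The pivotal exchange: both sides equal minus the integral of \<open>u\<close>
      against the derivative of the bump.\<close>
    also have "integral\<^sup>L ?M (\<lambda>x. \<psi> x *\<^sub>R u' x (0, 1)) = integral\<^sup>L ?M (\<lambda>x. \<psi> x *\<^sub>R g x)"
      using g(2)[unfolded weak_partial_def, rule_format, OF t] g'[unfolded weak_partial_def, rule_format, OF t]
      by simp
    also have "Re (a * integral\<^sup>L ?M (\<lambda>x. \<psi> x *\<^sub>R g x)) \<le> norm a * norm (integral\<^sup>L ?M (\<lambda>x. \<psi> x *\<^sub>R g x))"
      using complex_Re_le_cmod by (metis norm_mult)
    also have "norm (integral\<^sup>L ?M (\<lambda>x. \<psi> x *\<^sub>R g x)) \<le> integral\<^sup>L ?M (\<lambda>x. norm (\<psi> x *\<^sub>R g x))"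
      by (rule integral_norm_bound)
    also have "\<dots> \<le> integral\<^sup>L ?M (\<lambda>x. s / 2 * indicator K x + 1 / (2 * s) * (norm (g x))\<^sup>2)"
    proof (rule integral_mono_AE')
      show "integrable ?M (\<lambda>x. s / 2 * indicator K x + 1 / (2 * s) * (norm (g x))\<^sup>2)"
        using iK gi by auto
      have "norm (\<psi> x *\<^sub>R g x) \<le> s / 2 * indicator K x + 1 / (2 * s) * (norm (g x))\<^sup>2" for x
      proof (cases "x \<in> K")
        case True
        \<comment> \<open>Young's inequality, weighted so that both terms integrate to \<open>O(1/s)\<close>\<close>
        have "0 \<le> (s * \<psi> x - norm (g x))\<^sup>2" by simp
        then have "\<psi> x * norm (g x) \<le> s / 2 * (\<psi> x)\<^sup>2 + 1 / (2 * s) * (norm (g x))\<^sup>2"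
          using s0 by (simp add: field_simps power2_eq_square)
        moreover have "(\<psi> x)\<^sup>2 \<le> 1" using \<psi> by (simp add: power_le_one)
        then have "s / 2 * (\<psi> x)\<^sup>2 \<le> s / 2 * 1" using s0 by (intro mult_left_mono) auto
        ultimately show ?thesis using True \<psi> by simp
      qed (use \<psi>0 s0 in simp)
      then show "AE x in ?M. norm (\<psi> x *\<^sub>R g x) \<le> s / 2 * indicator K x + 1 / (2 * s) * (norm (g x))\<^sup>2" by simp
    qed (use s0 in \<open>auto intro!: AE_I2 add_nonneg_nonneg\<close>)
    also have "\<dots> = s / 2 * (v * (1 / 4 / s)\<^sup>2) + 1 / (2 * s) * N"
      using iK gi by (simp add: N_def)
    also have "\<dots> = (v / 16 + N) / (2 * s)" using s0 by (simp add: field_simps power2_eq_square)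
    finally show ?thesis by (simp add: mult_left_mono)
  qed
  \<comment> \<open>Cancelling the common \<open>1 / s\<close> in \<open>main\<close> leaves
    \<open>sqrt s\<close> on the left, so \<open>L\<close> would bound it for all large
    \<open>s\<close>.\<close>
  define L where "L = norm a * ((v / 16 + N) / 2) / (c * m * v / 64)"
  have sq: "sqrt s \<le> L" if "s \<ge> 1" "s > 1 / \<delta>" for s
  proof -
    have s: "s > 0" using that by simp
    have "s powr (3/2) = s * sqrt s"
      using s powr_add[of s 1 "1/2"] by (simp add: powr_half_sqrt)
    then have "sqrt s * (c * m * v / 64) / s \<le> norm a * ((v / 16 + N) / 2) / s"
      using main[OF that] s by (simp add: power2_eq_square mult_ac)
    then have "sqrt s * (c * m * v / 64) \<le> norm a * ((v / 16 + N) / 2)"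
      using s by (simp only: divide_le_cancel)
    then show ?thesis using c m v by (simp only: L_def pos_le_divide_eq mult_pos_pos divide_pos_pos zero_less_numeral)
  qed
  \<comment> \<open>Large enough for both side conditions, and with square root at least
    \<open>L + 1\<close>.\<close>
  define s where "s = 1 + 1 / \<delta> + (L + 1)\<^sup>2"
  have "s \<ge> 1" "s > 1 / \<delta>" using \<delta> by (auto simp: s_def add_pos_nonneg add_strict_increasing)
  then have "sqrt s \<le> L" by (rule sq)
  moreover have "sqrt ((L + 1)\<^sup>2) \<le> sqrt s"
    by (rule real_sqrt_le_mono) (use \<delta> in \<open>simp add: s_def\<close>)
  ultimately show False by simp
qed

text \<open>Expanding the sine of \<open>\<phi> + \<phi> / 2\<close>, the first product is at least
  \<open>1/4 * 1/2\<close> because \<open>0 < \<phi> \<le> pi / 2\<close>, and the second is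
  nonnegative.\<close>

lemma sector_trig:
  assumes x: "x \<in> sector" "x \<in> half_disc"
  shows "1 / 8 \<le> sin (3 / 2 * Arg (as_complex x))"
proof -
  define \<phi> where "\<phi> = Arg (as_complex x)"
  have r: "norm x > 0" using as_complex_half_disc x by blast
  have "as_complex x = rcis (norm x) \<phi>" using rcis_cmod_Arg[of "as_complex x"] by (simp add: \<phi>_def as_complex_simps)
  then have xy: "fst x = norm x * cos \<phi>" "snd x = norm x * sin \<phi>" by (metis as_complex_simps(1) Re_rcis, metis as_complex_simps(2) Im_rcis)
  have "0 < cos \<phi>" using x r xy(1) by (simp add: sector_def zero_less_mult_iff)
  have "norm x * 1 \<le> norm x * (4 * sin \<phi>)" using x xy(2) by (simp add: sector_def)
  then have s: "1 / 4 \<le> sin \<phi>" using r by (simp only: mult_le_cancel_left_pos)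
  have "0 < Im (as_complex x)" using x by (simp add: half_disc_eq as_complex_simps)
  then have \<phi>: "0 < \<phi>" "\<phi> < pi" using Arg_lt_pi unfolding \<phi>_def by auto
  have "\<phi> \<le> pi / 2"
  proof (rule ccontr)
    assume "\<not> \<phi> \<le> pi / 2"
    then have "cos \<phi> \<le> cos (pi / 2)" using \<phi> by (intro cos_monotone_0_pi_le) auto
    then show False using \<open>0 < cos \<phi>\<close> by simp
  qed
  then have "cos (pi / 3) \<le> cos (\<phi> / 2)" using \<phi> by (intro cos_monotone_0_pi_le) auto
  then have c2: "1 / 2 \<le> cos (\<phi> / 2)" by (simp add: cos_60)
  have "0 \<le> sin (\<phi> / 2)" using \<phi> by (intro sin_ge_zero) auto
  have "sin (3 / 2 * \<phi>) = sin (\<phi> + \<phi> / 2)" by (simp add: field_simps)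
  also have "\<dots> = sin \<phi> * cos (\<phi> / 2) + cos \<phi> * sin (\<phi> / 2)" by (rule sin_add)
  also have "\<dots> \<ge> 1 / 4 * (1 / 2) + 0"
    using s c2 \<open>0 < cos \<phi>\<close> \<open>0 \<le> sin (\<phi> / 2)\<close> by (intro add_mono mult_mono) auto
  finally show ?thesis by (simp add: \<phi>_def)
qed

text \<open>Differentiating \<open>z powr (-1/2)\<close> in the second coordinate gives the real
  part \<open>- 1/2 * r powr (-3/2) * sin (3/2 * \<phi>)\<close>, of fixed sign in the sector. All
  remaining terms, including the wave of order 3/2, are \<open>O(r powr (-1/2))\<close> and are
  absorbed near the origin. The parameter \<open>\<epsilon>\<close> treats sums and differences
  together.\<close>

lemma cyl_wave_singular_deriv:
  assumes \<omega>: "\<omega> > 0" and \<epsilon>: "\<bar>\<epsilon>\<bar> \<le> 1"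
  shows "\<exists>c>0. \<exists>\<delta>>0. \<forall>x\<in>half_disc. x \<in> sector \<longrightarrow> norm x < \<delta> \<longrightarrow>
    Re (cyl_wave_deriv (-1/2) \<omega> x (0, 1)) + \<epsilon> * Re (cyl_wave_deriv (3/2) \<omega> x (0, 1)) \<le> - (c * norm x powr (-3/2))"
proof -
  define k where "k = (\<omega> / 2) powr (-1/2)"
  define q where "q = (\<omega> / 2)\<^sup>2"
  \<comment> \<open>The constant coefficient of the series, equal to \<open>1 / Gamma (1/2)\<close>
    and hence positive.\<close>
  define g0 where "g0 = bessel_series (-1/2) 0"
  have k: "k > 0" and q: "q > 0" using \<omega> by (auto simp: k_def q_def)
  have b: "(0, 1) \<in> (Basis :: point set)" by (simp add: Basis_prod_def)
  have "g0 = rGamma (1 / 2)" by (simp only: g0_def bessel_series_def powser_zero) simp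
  then have g0: "g0 > 0" by (simp add: rGamma_inverse_Gamma Gamma_one_half_real)
  obtain G where G: "G \<ge> 0" "\<And>x::point. norm x < 1 \<Longrightarrow> \<bar>bessel_series (1/2) (q * (norm x)\<^sup>2)\<bar> \<le> G"
    using bessel_series_bounded by blast
  obtain C where C: "\<And>x. x \<in> half_disc \<Longrightarrow> norm (cyl_wave_deriv (3/2) \<omega> x (0, 1)) \<le> C * norm x powr (-1/2)"
    using cyl_wave_bounds[OF \<omega>, of "3/2"] b by auto
  have "(\<lambda>r. bessel_series (-1/2) (q * r\<^sup>2)) \<midarrow>0\<rightarrow> bessel_series (-1/2) (q * 0\<^sup>2)"
    by (intro isCont_tendsto_compose[OF DERIV_isCont[OF bessel_series_deriv]] tendsto_intros)
  then have "\<forall>\<^sub>F r in at 0. g0 / 2 < bessel_series (-1/2) (q * r\<^sup>2)"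
    by (rule order_tendstoD) (use g0 in \<open>simp add: g0_def\<close>)
  then obtain \<delta>1 where \<delta>1: "\<delta>1 > 0" "\<And>r. r \<noteq> 0 \<Longrightarrow> dist r 0 < \<delta>1 \<Longrightarrow> g0 / 2 < bessel_series (-1/2) (q * r\<^sup>2)"
    unfolding eventually_at by blast
  \<comment> \<open>The leading term is at most \<open>- 2 * c * r powr (-3/2)\<close>: the factors
    are 1/2 from the exponent, 1/8 from the sine and \<open>g0 / 2\<close> from the series. Half of
    it is kept; the other half pays for the errors, collected in \<open>D\<close>, once
    \<open>r < c / D\<close>.\<close>
  define c where "c = k * g0 / 64"
  define D where "D = k * (G * (2 * q)) + \<bar>C\<bar> + 1"
  have c: "c > 0" using k g0 by (simp add: c_def)
  have "k * (G * (2 * q)) \<ge> 0" using k G q by simp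
  then have D: "D > 0" unfolding D_def by linarith
  define \<delta> where "\<delta> = min \<delta>1 (c / D)"
  have "Re (cyl_wave_deriv (-1/2) \<omega> x (0, 1)) + \<epsilon> * Re (cyl_wave_deriv (3/2) \<omega> x (0, 1)) \<le> - (c * norm x powr (-3/2))"
    if x: "x \<in> half_disc" "x \<in> sector" "norm x < \<delta>" for x
  proof -
    define r where "r = norm x"
    define \<phi> where "\<phi> = Arg (as_complex x)"
    have r: "0 < r" "r < 1" "r < \<delta>1" "r < c / D" using x as_complex_half_disc[OF x(1)] by (auto simp: r_def \<delta>_def half_disc_eq)
    have Zh: "as_complex (0, 1) = \<i>" by (simp add: as_complex_def complex_eq_iff)
    have xh: "x \<bullet> (0, 1) = snd x" "\<bar>snd x\<bar> \<le> r"
      using norm_snd_le[of "snd x" "fst x"] by (auto simp: inner_prod_def r_def)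
    define P where "P = of_real (-1/2) * as_complex x powr of_real (-1/2 - 1) * \<i> * of_real (bessel_series (-1/2) (q * r\<^sup>2))"
    define Q where "Q = as_complex x powr of_real (-1/2) * of_real (bessel_series (1/2) (q * r\<^sup>2) * (2 * q * snd x))"
    have e: "cyl_wave_deriv (-1/2) \<omega> x (0, 1) = of_real k * (P - Q)"
      by (simp add: cyl_wave_deriv_def P_def Q_def Zh xh k_def q_def r_def)
    have "as_complex x powr of_real (-1/2 - 1) = of_real (r powr (-3/2)) * cis (- (3 / 2 * \<phi>))"
      using powr_real_polar[of "as_complex x" "-1/2 - 1"] as_complex_half_disc[OF x(1)] by (simp add: as_complex_simps r_def \<phi>_def)
    then have "Re P = - (1 / 2 * r powr (-3/2) * (sin (3 / 2 * \<phi>) * bessel_series (-1/2) (q * r\<^sup>2)))"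
      by (simp add: P_def)
    also have "\<dots> \<le> - (1 / 2 * r powr (-3/2) * (1 / 8 * (g0 / 2)))"
    proof -
      have "g0 / 2 \<le> bessel_series (-1/2) (q * r\<^sup>2)" using \<delta>1(2)[of r] r by simp
      then have "1 / 8 * (g0 / 2) \<le> sin (3 / 2 * \<phi>) * bessel_series (-1/2) (q * r\<^sup>2)"
        using sector_trig[OF x(2,1)] g0 by (intro mult_mono) (auto simp: \<phi>_def)
      then show ?thesis by (intro le_imp_neg_le mult_left_mono) auto
    qed
    finally have "k * Re P \<le> k * - (1 / 2 * r powr (-3/2) * (1 / 8 * (g0 / 2)))"
      using k by (intro mult_left_mono) auto
    then have P: "k * Re P \<le> - (2 * c * r powr (-3/2))" by (simp add: c_def field_simps)
    have "norm Q = r powr (-1/2) * (\<bar>bessel_series (1/2) (q * r\<^sup>2)\<bar> * (2 * q * \<bar>snd x\<bar>))"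
      unfolding Q_def norm_mult norm_as_complex_powr[OF x(1)] using q by (simp add: r_def abs_mult norm_mult)
    also have "\<dots> \<le> r powr (-1/2) * (G * (2 * q * 1))"
      using G(2)[of x] r xh q G(1) by (intro mult_left_mono mult_mono) (auto simp: r_def)
    finally have "k * norm Q \<le> k * (r powr (-1/2) * (G * (2 * q * 1)))" using k by (intro mult_left_mono) auto
    moreover have "k * - Re Q \<le> k * norm Q" using k abs_Re_le_cmod[of Q] by (intro mult_left_mono) auto
    ultimately have Q: "- (k * Re Q) \<le> k * (G * (2 * q)) * r powr (-1/2)" by (simp add: mult_ac)
    have "\<bar>\<epsilon> * Re (cyl_wave_deriv (3/2) \<omega> x (0, 1))\<bar> \<le> 1 * norm (cyl_wave_deriv (3/2) \<omega> x (0, 1))"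
      unfolding abs_mult using \<epsilon> abs_Re_le_cmod by (intro mult_mono) auto
    also have "\<dots> \<le> C * r powr (-1/2)" using C[OF x(1)] by (simp add: r_def)
    also have "\<dots> \<le> (\<bar>C\<bar> + 1) * r powr (-1/2)" by (intro mult_right_mono) auto
    finally have R: "\<epsilon> * Re (cyl_wave_deriv (3/2) \<omega> x (0, 1)) \<le> (\<bar>C\<bar> + 1) * r powr (-1/2)" by linarith
    have "D * r powr (-1/2) = (D * r) * r powr (-3/2)"
      using r powr_add[of r 1 "-3/2"] by simp
    also have "\<dots> \<le> c * r powr (-3/2)"
      using r(4) D by (intro mult_right_mono) (auto simp: field_simps)
    finally have "(k * (G * (2 * q))) * r powr (-1/2) + (\<bar>C\<bar> + 1) * r powr (-1/2) \<le> c * r powr (-3/2)"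
      by (simp add: D_def distrib_right)
    moreover have "Re (cyl_wave_deriv (-1/2) \<omega> x (0, 1)) = k * Re P - k * Re Q"
      unfolding e by (simp add: algebra_simps)
    ultimately show ?thesis using P Q R unfolding r_def[symmetric] by linarith
  qed
  moreover have "\<delta> > 0" using \<delta>1 c D by (simp add: \<delta>_def)
  ultimately show ?thesis using c by blast
qed

text \<open>The multiplier \<open>- inverse k\<close> removes the constant and makes the negative
  singular derivative positive, as \<open>not_H1_if_singular\<close> requires.\<close>

lemma combination_not_H1:
  assumes \<omega>: "\<omega> > 0" and \<epsilon>: "\<bar>\<epsilon>\<bar> \<le> 1" and k: "k \<noteq> 0"
    and u: "\<And>x. x \<in> half_disc \<Longrightarrow> u x = k * of_real (Re (cyl_wave (-1/2) \<omega> x) + \<epsilon> * Re (cyl_wave (3/2) \<omega> x))"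
  shows "u \<notin> H1 half_disc"
proof -
  define u' where "u' x h = k * of_real (Re (cyl_wave_deriv (-1/2) \<omega> x h) + \<epsilon> * Re (cyl_wave_deriv (3/2) \<omega> x h))" for x h
  note C = C1_on_cyl_wave[OF \<omega>]
  have "C1_on half_disc (\<lambda>x. k * of_real (Re (cyl_wave (-1/2) \<omega> x) + \<epsilon> * Re (cyl_wave (3/2) \<omega> x))) u'"
    using C[of "-1/2"] C[of "3/2"] unfolding C1_on_def u'_def
    by (auto intro!: has_derivative_mult_right has_derivative_of_real has_derivative_add has_derivative_Re continuous_intros)
  then have C1: "C1_on half_disc u u'"
    unfolding C1_on_def using u
    by (auto intro: has_derivative_transform_within_open[OF _ open_half_disc])
  obtain c \<delta> where c: "c > 0" and \<delta>: "\<delta> > 0" and low: "\<And>x. x \<in> half_disc \<Longrightarrow> x \<in> sector \<Longrightarrow> norm x < \<delta> \<Longrightarrow>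
    Re (cyl_wave_deriv (-1/2) \<omega> x (0, 1)) + \<epsilon> * Re (cyl_wave_deriv (3/2) \<omega> x (0, 1)) \<le> - (c * norm x powr (-3/2))"
    using cyl_wave_singular_deriv[OF \<omega> \<epsilon>] by blast
  show ?thesis
  proof (rule not_H1_if_singular[OF C1 c \<delta>, of "- inverse k"])
    fix x assume x: "x \<in> half_disc" "x \<in> sector" "norm x < \<delta>"
    have "- inverse k * u' x (0, 1) = of_real (- (Re (cyl_wave_deriv (-1/2) \<omega> x (0, 1)) + \<epsilon> * Re (cyl_wave_deriv (3/2) \<omega> x (0, 1))))"
    proof -
      have "- inverse k * (k * z) = - z" for z using k by simp
      then show ?thesis by (simp only: u'_def of_real_minus)
    qed
    then show "c * norm x powr (-3/2) \<le> Re (- inverse k * u' x (0, 1))"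
      using low[OF x] by (simp only: Re_complex_of_real)
  qed
qed

text \<open>For \<open>n = 1\<close> the orders are \<open>-1/2\<close> and \<open>3/2\<close>. One
  component outside \<open>H1\<close> suffices, and the first is chosen: it is a difference for
  \<open>H20\<close> (\<open>\<epsilon> = -1\<close>) and a sum for \<open>E21\<close>
  (\<open>\<epsilon> = 1\<close>).\<close>

lemma
  assumes "\<omega> > 0"
  shows H20_not_H1: "\<not> components1 (H20 1 \<omega>) \<subseteq> H1 half_disc"
    and E21_not_H1: "\<not> components1 (E21 1 \<omega>) \<subseteq> H1 half_disc"
proof -
  have "(\<lambda>x. fst (H20 1 \<omega> x)) \<notin> H1 half_disc"
    by (rule combination_not_H1[OF assms, of "-1" "\<i> / 2"]) (use assms in \<open>auto simp: cyl_wave_components\<close>)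
  moreover have "(\<lambda>x. fst (E21 1 \<omega> x)) \<notin> H1 half_disc"
    by (rule combination_not_H1[OF assms, of "1" "- 1 / 2"]) (use assms in \<open>auto simp: cyl_wave_components\<close>)
  ultimately show "\<not> components1 (H20 1 \<omega>) \<subseteq> H1 half_disc" "\<not> components1 (E21 1 \<omega>) \<subseteq> H1 half_disc"
    by (auto simp: components1_def)
qed

theorem mainTheorem14:
  fixes \<omega>0 \<omega>1 :: "nat \<Rightarrow> nat \<Rightarrow> real"
  assumes "\<And>n. n \<ge> 1 \<Longrightarrow>
      bij_betw (\<omega>0 n) {1..} {x. x > 0 \<and> bessel_J (real n - 1/2) x = 0}"
    and "\<And>n. n \<ge> 1 \<Longrightarrow>
      bij_betw (\<omega>1 n) {1..} {x. x > 0 \<and> deriv (bessel_J (real n - 1/2)) x = 0}"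
  shows "\<forall>n\<ge>1. \<forall>m\<ge>1.
      components0 (E20 n (\<omega>0 n m)) \<subseteq> H1 half_disc \<and>
      (components1 (H20 n (\<omega>0 n m)) \<subseteq> H1 half_disc \<longleftrightarrow> n \<noteq> 1) \<and>
      (components1 (E21 n (\<omega>1 n m)) \<subseteq> H1 half_disc \<longleftrightarrow> n \<noteq> 1) \<and>
      components2 (H21 n (\<omega>1 n m)) \<subseteq> H1 half_disc"
proof (intro allI impI)
  fix n m :: nat
  assume n: "n \<ge> 1" and m: "m \<ge> 1"
  have pos: "\<omega>0 n m > 0" "\<omega>1 n m > 0"
    using bij_betwE[OF assms(1)[OF n]] bij_betwE[OF assms(2)[OF n]] m by auto
  have "components1 (H20 n (\<omega>0 n m)) \<subseteq> H1 half_disc \<longleftrightarrow> n \<noteq> 1"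
    using H20_H1[OF pos(1) n] H20_not_H1[OF pos(1)] by blast
  moreover have "components1 (E21 n (\<omega>1 n m)) \<subseteq> H1 half_disc \<longleftrightarrow> n \<noteq> 1"
    using E21_H1[OF pos(2) n] E21_not_H1[OF pos(2)] by blast
  ultimately show "components0 (E20 n (\<omega>0 n m)) \<subseteq> H1 half_disc \<and>
      (components1 (H20 n (\<omega>0 n m)) \<subseteq> H1 half_disc \<longleftrightarrow> n \<noteq> 1) \<and>
      (components1 (E21 n (\<omega>1 n m)) \<subseteq> H1 half_disc \<longleftrightarrow> n \<noteq> 1) \<and>
      components2 (H21 n (\<omega>1 n m)) \<subseteq> H1 half_disc"
    using E20_H1[OF pos(1) n] H21_H1[OF pos(2) n] by (simp add: components0_def components2_def)
qed

end
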